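(* If $X$ is a path-connected space, $x_0\in X$, and $H$ is a subgroup of $\pi_1(X,x_0)$, then the following conditions are equivalent: (a) the endpoint projection $p_H\colon (\widehat X_H,\widehat x_0)\to (X,x_0)$ has the unique path lifting property; (b) $p_H\colon \widehat X_H\to X$ is a Peano covering map.
   Context: $\widehat X_H$ is the set of equivalence classes $[\alpha]_H$ of paths $\alpha$ in $X$ with $\alpha(0)=x_0$ under the relation: $\alpha\sim_H\beta$ iff $\alpha(1)=\beta(1)$ and $[\alpha\ast\beta^{-1}]\in H$. It carries the topology with basis the sets $B_H([\alpha]_H,U)$, where $U$ is open in $X$, $\alpha$ is a path from $x_0$ to a point of $U$, and $[\beta]_H\in B_H([\alpha]_H,U)$ iff there is a path $\gamma$ in $U$ from $\alpha(1)$ to $\beta(1)$ with $\beta\sim_H\alpha\ast\gamma$. The base-point $\widehat x_0$ is the class of the constant path at $x_0$, and $p_H([\alpha]_H)=\alpha(1)$. A pointed map $f\colon (A,a_0)\to (B,b_0)$ has the unique path lifting property if (i) every path $\alpha\colon(I,0)\to(B,b_0)$ has a lift $\beta\colon (I,0)\to(A,a_0)$, and (ii) any two paths $\alpha,\beta\colon(I,0)\to(A,a_0)$ with $f\circ\alpha=f\circ\beta$ are equal. A map $f\colon A\to B$ is a Peano map if the family of path components of $f^{-1}(U)$, $U$ open in $B$, forms a basis of (open) neighborhoods of $A$. A map is a Serre fibration if it has the homotopy lifting property with respect to all cubes $I^n$, $n\ge 0$. A map $f\colon A\to B$ is a Peano covering map if it is a Peano map, it is a Serre fibration, and the fibers of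 $f$ have trivial (one-point) path components. *)

theory Defs
  imports "HOL-Analysis.Analysis" "HOL-Algebra.Group"
begin

section \<open>Paths and the fundamental group of a topological space\<close>

text \<open>
  Spaces are values of type \<open>'a topology\<close> and paths are functions satisfying \<^const>\<open>pathin\<close>, so
  only their values on \<open>{0..1}\<close> matter. The library's \<^const>\<open>joinpaths\<close>, \<^const>\<open>reversepath\<close> and
  \<^const>\<open>homotopic_paths\<close> require the points to belong to the type class \<open>topological_space\<close>;
  the following three definitions are their counterparts for an arbitrary topology.
\<close>

definition path_join :: "(real \<Rightarrow> 'a) \<Rightarrow> (real \<Rightarrow> 'a) \<Rightarrow> real \<Rightarrow> 'a"  (infixr \<open>\<star>\<close> 75)
  where "\<alpha> \<star> \<beta> = (\<lambda>t. if t \<le> 1/2 then \<alpha> (2 * t) else \<beta> (2 * t - 1))"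

definition path_reverse :: "(real \<Rightarrow> 'a) \<Rightarrow> real \<Rightarrow> 'a"
  where "path_reverse \<alpha> = (\<lambda>t. \<alpha> (1 - t))"

definition path_homotopic :: "'a topology \<Rightarrow> (real \<Rightarrow> 'a) \<Rightarrow> (real \<Rightarrow> 'a) \<Rightarrow> bool"
  where "path_homotopic X \<alpha> \<beta> \<longleftrightarrow>
    homotopic_with (\<lambda>\<gamma>. \<gamma> 0 = \<alpha> 0 \<and> \<gamma> 1 = \<alpha> 1) (top_of_set {0..1}) X \<alpha> \<beta>"

definition path_class :: "'a topology \<Rightarrow> (real \<Rightarrow> 'a) \<Rightarrow> (real \<Rightarrow> 'a) set"
  where "path_class X \<alpha> = {\<beta>. path_homotopic X \<alpha> \<beta>}"

definition fundamental_group :: "'a topology \<Rightarrow> 'a \<Rightarrow> (real \<Rightarrow> 'a) set monoid"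
  where "fundamental_group X x\<^sub>0 =
    \<lparr>carrier = path_class X ` {\<alpha>. pathin X \<alpha> \<and> \<alpha> 0 = x\<^sub>0 \<and> \<alpha> 1 = x\<^sub>0},
     mult = (\<lambda>a b. \<Union>\<alpha>\<in>a. \<Union>\<beta>\<in>b. path_class X (\<alpha> \<star> \<beta>)),
     one = path_class X (\<lambda>_. x\<^sub>0)\<rparr>"

section \<open>The space of \<open>H\<close>-classes of paths\<close>

definition based_paths :: "'a topology \<Rightarrow> 'a \<Rightarrow> (real \<Rightarrow> 'a) set"
  where "based_paths X x\<^sub>0 = {\<alpha>. pathin X \<alpha> \<and> \<alpha> 0 = x\<^sub>0}"

definition hat_rel :: "'a topology \<Rightarrow> 'a \<Rightarrow> (real \<Rightarrow> 'a) set set \<Rightarrow> ((real \<Rightarrow> 'a) \<times> (real \<Rightarrow> 'a)) set"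
  where "hat_rel X x\<^sub>0 H =
    {(\<alpha>, \<beta>). \<alpha> \<in> based_paths X x\<^sub>0 \<and> \<beta> \<in> based_paths X x\<^sub>0 \<and>
             \<alpha> 1 = \<beta> 1 \<and> path_class X (\<alpha> \<star> path_reverse \<beta>) \<in> H}"

definition hat_class :: "'a topology \<Rightarrow> 'a \<Rightarrow> (real \<Rightarrow> 'a) set set \<Rightarrow> (real \<Rightarrow> 'a) \<Rightarrow> (real \<Rightarrow> 'a) set"
  where "hat_class X x\<^sub>0 H \<alpha> = hat_rel X x\<^sub>0 H `` {\<alpha>}"

definition hat_nbhd ::
    "'a topology \<Rightarrow> 'a \<Rightarrow> (real \<Rightarrow> 'a) set set \<Rightarrow> (real \<Rightarrow> 'a) \<Rightarrow> 'a set \<Rightarrow> (real \<Rightarrow> 'a) set set"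
  where "hat_nbhd X x\<^sub>0 H \<alpha> U =
    {hat_class X x\<^sub>0 H \<beta> | \<beta>. \<beta> \<in> based_paths X x\<^sub>0 \<and>
       (\<exists>\<gamma>. pathin (subtopology X U) \<gamma> \<and> \<gamma> 0 = \<alpha> 1 \<and> \<gamma> 1 = \<beta> 1 \<and>
            (\<beta>, \<alpha> \<star> \<gamma>) \<in> hat_rel X x\<^sub>0 H)}"

text \<open>
  For a subgroup \<open>H\<close> the generating sets form a basis: write \<open>B \<alpha> U\<close> for \<open>hat_nbhd X x\<^sub>0 H \<alpha> U\<close>;
  if the class of \<open>\<delta>\<close> lies in \<open>B \<alpha> U \<inter> B \<beta> V\<close>, then it lies in
  \<open>B \<delta> (U \<inter> V)\<close>, which is contained in \<open>B \<alpha> U \<inter> B \<beta> V\<close>. The generated topology is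
  therefore the one having these sets as a basis.
\<close>

definition hat_space :: "'a topology \<Rightarrow> 'a \<Rightarrow> (real \<Rightarrow> 'a) set set \<Rightarrow> (real \<Rightarrow> 'a) set topology"
  where "hat_space X x\<^sub>0 H = topology_generated_by
    {hat_nbhd X x\<^sub>0 H \<alpha> U | \<alpha> U. openin X U \<and> \<alpha> \<in> based_paths X x\<^sub>0 \<and> \<alpha> 1 \<in> U}"

definition hat_base :: "'a topology \<Rightarrow> 'a \<Rightarrow> (real \<Rightarrow> 'a) set set \<Rightarrow> (real \<Rightarrow> 'a) set"
  where "hat_base X x\<^sub>0 H = hat_class X x\<^sub>0 H (\<lambda>_. x\<^sub>0)"

text \<open>All members of a class have the same endpoint, so the image below is a singleton.\<close>

definition hat_proj :: "(real \<Rightarrow> 'a) set \<Rightarrow> 'a"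
  where "hat_proj c = the_elem ((\<lambda>\<alpha>. \<alpha> 1) ` c)"

section \<open>Unique path lifting, Peano maps, Serre fibrations, Peano covering maps\<close>

definition unique_path_lifting :: "'a topology \<Rightarrow> 'a \<Rightarrow> 'b topology \<Rightarrow> 'b \<Rightarrow> ('a \<Rightarrow> 'b) \<Rightarrow> bool"
  where "unique_path_lifting A a\<^sub>0 B b\<^sub>0 f \<longleftrightarrow>
    continuous_map A B f \<and> a\<^sub>0 \<in> topspace A \<and> f a\<^sub>0 = b\<^sub>0 \<and>
    (\<forall>\<alpha>. pathin B \<alpha> \<and> \<alpha> 0 = b\<^sub>0 \<longrightarrow>
       (\<exists>\<beta>. pathin A \<beta> \<and> \<beta> 0 = a\<^sub>0 \<and> (\<forall>t\<in>{0..1}. f (\<beta> t) = \<alpha> t))) \<and>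
    (\<forall>\<alpha> \<beta>. pathin A \<alpha> \<and> \<alpha> 0 = a\<^sub>0 \<and> pathin A \<beta> \<and> \<beta> 0 = a\<^sub>0 \<and>
       (\<forall>t\<in>{0..1}. f (\<alpha> t) = f (\<beta> t)) \<longrightarrow> (\<forall>t\<in>{0..1}. \<alpha> t = \<beta> t))"

definition Peano_map :: "'a topology \<Rightarrow> 'b topology \<Rightarrow> ('a \<Rightarrow> 'b) \<Rightarrow> bool"
  where "Peano_map A B f \<longleftrightarrow>
    continuous_map A B f \<and>
    openin A = arbitrary union_of
      (\<lambda>C. \<exists>U. openin B U \<and> C \<in> path_components_of (subtopology A {a \<in> topspace A. f a \<in> U}))"

definition homotopy_lifting_property ::
    "'c topology \<Rightarrow> 'a topology \<Rightarrow> 'b topology \<Rightarrow> ('a \<Rightarrow> 'b) \<Rightarrow> bool"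
  where "homotopy_lifting_property Z A B f \<longleftrightarrow>
    (\<forall>g h. continuous_map Z A g \<and>
           continuous_map (prod_topology Z (top_of_set {0..1::real})) B h \<and>
           (\<forall>z\<in>topspace Z. h (z, 0) = f (g z)) \<longrightarrow>
       (\<exists>k. continuous_map (prod_topology Z (top_of_set {0..1::real})) A k \<and>
            (\<forall>z\<in>topspace Z. k (z, 0) = g z) \<and>
            (\<forall>z\<in>topspace Z. \<forall>t\<in>{0..1}. f (k (z, t)) = h (z, t))))"

definition cube :: "nat \<Rightarrow> (nat \<Rightarrow> real) topology"
  where "cube n = product_topology (\<lambda>_. top_of_set {0..1}) {..<n}"

definition Serre_fibration :: "'a topology \<Rightarrow> 'b topology \<Rightarrow> ('a \<Rightarrow> 'b) \<Rightarrow> bool"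
  where "Serre_fibration A B f \<longleftrightarrow>
    continuous_map A B f \<and> (\<forall>n. homotopy_lifting_property (cube n) A B f)"

definition Peano_covering_map :: "'a topology \<Rightarrow> 'b topology \<Rightarrow> ('a \<Rightarrow> 'b) \<Rightarrow> bool"
  where "Peano_covering_map A B f \<longleftrightarrow>
    Peano_map A B f \<and> Serre_fibration A B f \<and>
    (\<forall>b\<in>topspace B. \<forall>C\<in>path_components_of (subtopology A {a \<in> topspace A. f a = b}). \<exists>a. C = {a})"

end

theory Submission
  imports Defs
begin

text \<open>
  Write \<open>B \<alpha> U\<close> for the basic set \<open>hat_nbhd X x\<^sub>0 H \<alpha> U\<close> and \<open>p\<close> for the endpoint projection.

  Only uniqueness of lifts is at stake. A path \<open>\<alpha>\<close> from \<open>x\<^sub>0\<close> always has the lift sending \<open>t\<close> to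
  the class of \<open>\<alpha>\<close> restricted to \<open>[0, t]\<close>; it joins the base point to the class of \<open>\<alpha>\<close>. Moreover
  \<open>p\<close> is always a Peano map: for fixed open \<open>U\<close> the sets \<open>B \<alpha> U\<close> partition the preimage of \<open>U\<close>
  into open sets, and each of them is path connected by the lifts just described, so they are its
  path components (\<open>path_component_preimage\<close>).

  Suppose lifts from the base point are unique. They are then unique from every point
  (\<open>unique_lift_of_path\<close>), since every point is the end of a path from the base point, and so are
  the lifts of a map on a path-connected space once one value is prescribed. The first fact, applied
  to a constant path, makes the path components of the fibres trivial. For the homotopy lifting
  property, let \<open>h\<close> be a map on \<open>I\<^sup>n \<times> I\<close> and let \<open>\<alpha>\<close> represent the value prescribed at some point
  \<open>z\<^sub>0\<close> of the bottom face. Sending \<open>z\<close> to the class of \<open>\<alpha>\<close> followed by the \<open>h\<close>-image of the segment from \<open>z\<^sub>0\<close>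
  to \<open>z\<close> is a continuous lift of \<open>h\<close> (\<open>equiconnected_lift\<close>), and by uniqueness it agrees with the
  prescribed initial lift on the whole bottom face. All that is used of the cube is a continuous
  choice of connecting paths; the notion of an equiconnected space isolates this, and the unit
  interval, being another instance, yields the path lifts above.

  Conversely, let \<open>p\<close> be a Serre fibration whose fibres have trivial path components, and let
  \<open>\<alpha>\<close>, \<open>\<beta>\<close> be lifts of one path with the same start. Going back along \<open>\<alpha>\<close> from \<open>\<alpha> t\<close> and then out
  along \<open>\<beta>\<close> to \<open>\<beta> t\<close> lifts a loop of the form \<open>\<gamma>\<close> reversed followed by \<open>\<gamma>\<close>. That loop contracts
  with its ends fixed; in a lift of the contraction the three remaining sides of the square lie in
  one fibre and join \<open>\<alpha> t\<close> to \<open>\<beta> t\<close>, which are therefore equal (\<open>Serre_fibration_unique_lift\<close>).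
\<close>

section \<open>Equiconnected spaces\<close>

abbreviation unit_interval :: "real topology"
  where "unit_interval \<equiv> top_of_set {0..1}"

lemma continuous_map_compose_fun:
  "continuous_map X Y f \<Longrightarrow> continuous_map Y Z g \<Longrightarrow> continuous_map X Z (\<lambda>x. g (f x))"
  using continuous_map_compose[of X Y f Z g] unfolding o_def by blast

text \<open>
  The map \<open>L\<close> chooses a path \<open>L x y\<close> from \<open>x\<close> to \<open>y\<close>, continuously in \<open>x\<close> and \<open>y\<close> and constantly on
  the diagonal. The last condition keeps \<open>L x y\<close> close to \<open>x\<close> when \<open>y\<close> is, and also fixes the ends
  when \<open>L\<close> is used to deform one path into another.
\<close>

definition equiconnecting :: "'c topology \<Rightarrow> ('c \<Rightarrow> 'c \<Rightarrow> real \<Rightarrow> 'c) \<Rightarrow> bool"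
  where "equiconnecting Z L \<longleftrightarrow>
    continuous_map (prod_topology Z (prod_topology Z unit_interval)) Z (\<lambda>(x, y, t). L x y t) \<and>
    (\<forall>x\<in>topspace Z. \<forall>y\<in>topspace Z. L x y 0 = x \<and> L x y 1 = y) \<and>
    (\<forall>x\<in>topspace Z. \<forall>t\<in>{0..1}. L x x t = x)"

lemma equiconnecting_ends:
  assumes "equiconnecting Z L" "x \<in> topspace Z" "y \<in> topspace Z"
  shows "L x y 0 = x" "L x y 1 = y"
  using assms by (auto simp: equiconnecting_def)

lemma equiconnecting_diagonal:
  assumes "equiconnecting Z L" "x \<in> topspace Z" "0 \<le> t" "t \<le> 1"
  shows "L x x t = x"
  using assms by (auto simp: equiconnecting_def)

lemma continuous_map_equiconnecting:
  assumes "equiconnecting Z L" "continuous_map W Z a" "continuous_map W Z b"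
    and "continuous_map W unit_interval c"
  shows "continuous_map W Z (\<lambda>w. L (a w) (b w) (c w))"
proof -
  have "continuous_map W (prod_topology Z (prod_topology Z unit_interval)) (\<lambda>w. (a w, b w, c w))"
    using assms by (intro continuous_map_pairedI)
  moreover have "continuous_map (prod_topology Z (prod_topology Z unit_interval)) Z (\<lambda>(x, y, t). L x y t)"
    using assms(1) by (simp add: equiconnecting_def)
  ultimately have "continuous_map W Z (\<lambda>w. case (a w, b w, c w) of (x, y, t) \<Rightarrow> L x y t)"
    by (rule continuous_map_compose_fun)
  then show ?thesis by simp
qed

lemma equiconnecting_path:
  assumes "equiconnecting Z L" "x \<in> topspace Z" "y \<in> topspace Z"
  shows "pathin Z (L x y)"
  unfolding pathin_def
  by (rule continuous_map_equiconnecting[OF assms(1)]) (use assms in simp_all)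

lemma equiconnecting_convex:
  fixes S :: "'b::real_normed_vector set"
  assumes "convex S"
  shows "equiconnecting (top_of_set S) (\<lambda>x y t. (1 - t) *\<^sub>R x + t *\<^sub>R y)"
proof -
  have "continuous_on (S \<times> S \<times> {0..1}) (\<lambda>(x, y, t). (1 - t) *\<^sub>R x + t *\<^sub>R y)"
    unfolding case_prod_unfold by (intro continuous_intros)
  moreover have "(\<lambda>(x, y, t). (1 - t) *\<^sub>R x + t *\<^sub>R y) \<in> S \<times> S \<times> {0..1} \<rightarrow> S"
    using assms by (auto simp: convex_alt)
  ultimately have "continuous_map (top_of_set (S \<times> S \<times> {0..1})) (top_of_set S)
      (\<lambda>(x, y, t). (1 - t) *\<^sub>R x + t *\<^sub>R y)"
    by (auto simp: continuous_map_in_subtopology)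
  then show ?thesis
    by (auto simp: equiconnecting_def simp flip: scaleR_left_distrib)
qed

lemma equiconnecting_prod:
  assumes "equiconnecting Z L" "equiconnecting W M"
  shows "equiconnecting (prod_topology Z W)
           (\<lambda>x y t. (L (fst x) (fst y) t, M (snd x) (snd y) t))"
proof -
  let ?P = "prod_topology Z W"
  let ?T = "prod_topology ?P (prod_topology ?P unit_interval)"
  have fst: "continuous_map ?T ?P fst"
    by (rule continuous_map_fst)
  have snd: "continuous_map ?T ?P (\<lambda>z. fst (snd z))"
    by (rule continuous_map_compose_fun[OF continuous_map_snd continuous_map_fst])
  have par: "continuous_map ?T unit_interval (\<lambda>z. snd (snd z))"
    by (rule continuous_map_compose_fun[OF continuous_map_snd continuous_map_snd])
  have "continuous_map ?T ?P (\<lambda>z. (L (fst (fst z)) (fst (fst (snd z))) (snd (snd z)),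
      M (snd (fst z)) (snd (fst (snd z))) (snd (snd z))))"
    by (intro continuous_map_pairedI continuous_map_equiconnecting[OF assms(1)]
        continuous_map_equiconnecting[OF assms(2)] par)
      (rule continuous_map_compose_fun[OF fst] continuous_map_compose_fun[OF snd],
        rule continuous_map_fst continuous_map_snd)+
  then show ?thesis
    using assms by (auto simp: equiconnecting_def case_prod_unfold)
qed

lemma equiconnecting_product:
  assumes "\<And>i. i \<in> I \<Longrightarrow> equiconnecting (Z i) (L i)"
  shows "equiconnecting (product_topology Z I) (\<lambda>x y t. \<lambda>i\<in>I. L i (x i) (y i) t)"
proof -
  let ?P = "product_topology Z I"
  let ?T = "prod_topology ?P (prod_topology ?P unit_interval)"
  have fst: "continuous_map ?T ?P fst"
    by (rule continuous_map_fst)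
  have snd: "continuous_map ?T ?P (\<lambda>z. fst (snd z))"
    by (rule continuous_map_compose_fun[OF continuous_map_snd continuous_map_fst])
  have par: "continuous_map ?T unit_interval (\<lambda>z. snd (snd z))"
    by (rule continuous_map_compose_fun[OF continuous_map_snd continuous_map_snd])
  have "continuous_map ?T (Z i) (\<lambda>z. L i (fst z i) (fst (snd z) i) (snd (snd z)))" if "i \<in> I" for i
    by (intro continuous_map_equiconnecting[OF assms[OF that]] par
        continuous_map_compose_fun[OF fst continuous_map_product_projection]
        continuous_map_compose_fun[OF snd continuous_map_product_projection] that)
  then have "continuous_map ?T ?P (\<lambda>z. \<lambda>i\<in>I. L i (fst z i) (fst (snd z) i) (snd (snd z)))"
    by (auto simp: continuous_map_componentwise)
  moreover have "(\<lambda>i\<in>I. L i (x i) (y i) 0) = x" "(\<lambda>i\<in>I. L i (x i) (y i) 1) = y"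
    if "x \<in> topspace ?P" "y \<in> topspace ?P" for x y
    using that equiconnecting_ends[OF assms] by (fastforce simp: PiE_iff extensional_def)+
  moreover have "(\<lambda>i\<in>I. L i (x i) (x i) t) = x" if "x \<in> topspace ?P" "t \<in> {0..1}" for x t
    using that equiconnecting_diagonal[OF assms] by (fastforce simp: PiE_iff extensional_def)
  ultimately show ?thesis
    by (auto simp: equiconnecting_def case_prod_unfold)
qed

lemma equiconnecting_imp_path_connected_space:
  assumes "equiconnecting Z L"
  shows "path_connected_space Z"
  unfolding path_connected_space_def
proof (intro ballI exI conjI)
  fix x y assume "x \<in> topspace Z" "y \<in> topspace Z"
  then show "pathin Z (L x y)" "L x y 0 = x" "L x y 1 = y"
    using assms by (simp_all add: equiconnecting_path equiconnecting_ends)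
qed


section \<open>Path homotopy\<close>

text \<open>
  \<open>homotopic_with\<close> prescribes the homotopy at times 0 and 1 on the whole real line; the values outside
  the unit interval can be patched in, because continuity only concerns the unit square.
\<close>

lemma path_homotopicI:
  assumes h: "continuous_map (prod_topology unit_interval unit_interval) X h"
    and "\<And>t. t \<in> {0..1} \<Longrightarrow> h (0, t) = \<alpha> t" "\<And>t. t \<in> {0..1} \<Longrightarrow> h (1, t) = \<beta> t"
    and "\<And>s. s \<in> {0..1} \<Longrightarrow> h (s, 0) = \<alpha> 0" "\<And>s. s \<in> {0..1} \<Longrightarrow> h (s, 1) = \<alpha> 1"
  shows "path_homotopic X \<alpha> \<beta>"
proof -
  define k where "k = (\<lambda>(s::real, t). if t \<in> {0..1} then h (s, t) else if s = 0 then \<alpha> t else \<beta> t)"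
  have "continuous_map (prod_topology unit_interval unit_interval) X k"
    by (rule continuous_map_eq[OF h]) (auto simp: k_def)
  then show ?thesis
    unfolding path_homotopic_def homotopic_with_def
    using assms by (intro exI[of _ k]) (auto simp: k_def)
qed

lemma path_homotopicE:
  assumes "path_homotopic X \<alpha> \<beta>"
  obtains h where "continuous_map (prod_topology unit_interval unit_interval) X h"
    and "\<And>t. h (0, t) = \<alpha> t" "\<And>t. h (1, t) = \<beta> t"
    and "\<And>s. s \<in> {0..1} \<Longrightarrow> h (s, 0) = \<alpha> 0" "\<And>s. s \<in> {0..1} \<Longrightarrow> h (s, 1) = \<alpha> 1"
proof -
  from assms obtain h where "continuous_map (prod_topology unit_interval unit_interval) X h"
    and "\<forall>t. h (0, t) = \<alpha> t" "\<forall>t. h (1, t) = \<beta> t"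
    and "\<forall>s\<in>{0..1}. h (s, 0) = \<alpha> 0 \<and> h (s, 1) = \<alpha> 1"
    unfolding path_homotopic_def homotopic_with_def by (elim exE conjE)
  then show thesis
    by (intro that[of h]) simp_all
qed

lemma path_homotopic_imp_pathin:
  assumes "path_homotopic X \<alpha> \<beta>"
  shows "pathin X \<alpha>" "pathin X \<beta>"
  using homotopic_with_imp_continuous_maps[OF assms[unfolded path_homotopic_def]]
  by (simp_all add: pathin_def)

lemma path_homotopic_ends:
  assumes "path_homotopic X \<alpha> \<beta>"
  shows "\<beta> 0 = \<alpha> 0" "\<beta> 1 = \<alpha> 1"
  using homotopic_with_imp_property[OF assms[unfolded path_homotopic_def]] by simp_all

lemma path_homotopic_cong:
  assumes "pathin X \<alpha>" "\<And>t. t \<in> {0..1} \<Longrightarrow> \<alpha> t = \<beta> t"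
  shows "path_homotopic X \<alpha> \<beta>"
  unfolding path_homotopic_def
  by (rule homotopic_with_equal) (use assms in \<open>auto simp: pathin_def\<close>)

lemma path_homotopic_refl: "pathin X \<alpha> \<Longrightarrow> path_homotopic X \<alpha> \<alpha>"
  by (simp add: path_homotopic_cong)

lemma path_homotopic_sym:
  assumes "path_homotopic X \<alpha> \<beta>"
  shows "path_homotopic X \<beta> \<alpha>"
  using homotopic_with_symD[OF assms[unfolded path_homotopic_def]] path_homotopic_ends[OF assms]
  by (simp add: path_homotopic_def)

lemma path_homotopic_trans [trans]:
  assumes "path_homotopic X \<alpha> \<beta>" "path_homotopic X \<beta> \<gamma>"
  shows "path_homotopic X \<alpha> \<gamma>"
  using assms homotopic_with_trans[of _ "top_of_set {0..1}" X \<alpha> \<beta> \<gamma>] path_homotopic_ends[OF assms(1)]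
  by (simp add: path_homotopic_def)

text \<open>
  Two paths \<open>a\<close>, \<open>b\<close> with the same ends in an equiconnected space are homotopic by moving \<open>a t\<close> to
  \<open>b t\<close> along \<open>L (a t) (b t)\<close>. For the unit interval this gives the homotopies between
  reparametrizations of one path, hence the groupoid laws for concatenation.
\<close>

lemma path_homotopic_equiconnected:
  assumes L: "equiconnecting Z L" and f: "continuous_map Z X f"
    and a: "pathin Z a" and b: "pathin Z b" and ends: "a 0 = b 0" "a 1 = b 1"
  shows "path_homotopic X (\<lambda>t. f (a t)) (\<lambda>t. f (b t))"
proof -
  let ?S = "prod_topology unit_interval unit_interval"
  have a_in: "a t \<in> topspace Z" and b_in: "b t \<in> topspace Z" if "t \<in> {0..1}" for t
    using a b that unfolding pathin_def continuous_map_def by auto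
  have ends_in: "b 0 \<in> topspace Z" "b 1 \<in> topspace Z"
    by (simp_all add: b_in)
  have "continuous_map ?S Z (\<lambda>w. L (a (snd w)) (b (snd w)) (fst w))"
    by (intro continuous_map_equiconnecting[OF L] continuous_map_fst
        continuous_map_compose_fun[OF continuous_map_snd a[unfolded pathin_def]]
        continuous_map_compose_fun[OF continuous_map_snd b[unfolded pathin_def]])
  then have "continuous_map ?S X (\<lambda>w. f (L (a (snd w)) (b (snd w)) (fst w)))"
    by (rule continuous_map_compose_fun[OF _ f])
  then show ?thesis
    by (rule path_homotopicI)
      (use a_in b_in in \<open>simp_all add: ends ends_in equiconnecting_ends[OF L] equiconnecting_diagonal[OF L]\<close>)
qed

text \<open>
  With a parameter space \<open>W\<close> one gluing argument covers both the concatenation of two paths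
  and that of two homotopies.
\<close>

lemma continuous_map_path_join:
  assumes a: "continuous_map (prod_topology W unit_interval) X (\<lambda>(w, t). a w t)"
    and b: "continuous_map (prod_topology W unit_interval) X (\<lambda>(w, t). b w t)"
    and ab: "\<And>w. w \<in> topspace W \<Longrightarrow> a w 1 = b w 0"
  shows "continuous_map (prod_topology W unit_interval) X (\<lambda>(w, t). (a w \<star> b w) t)"
proof -
  let ?P = "prod_topology W unit_interval"
  have snd: "continuous_map ?P euclideanreal snd"
    using continuous_map_snd[of W unit_interval] continuous_map_in_subtopology by blast
  have part: "continuous_map (subtopology ?P S) X (\<lambda>z. c (fst z) (r * snd z + d))"
    if c: "continuous_map ?P X (\<lambda>(w, t). c w t)" and "\<And>z. z \<in> S \<Longrightarrow> r * snd z + d \<in> {0..1}"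
    for S c and r d :: real
  proof -
    have "continuous_map ?P euclideanreal (\<lambda>z. r * snd z + d)"
      using snd by (intro continuous_intros)
    then have "continuous_map (subtopology ?P S) euclideanreal (\<lambda>z. r * snd z + d)"
      by (rule continuous_map_from_subtopology)
    then have "continuous_map (subtopology ?P S) unit_interval (\<lambda>z. r * snd z + d)"
      by (rule continuous_map_into_subtopology) (use that in auto)
    then have "continuous_map (subtopology ?P S) ?P (\<lambda>z. (fst z, r * snd z + d))"
      by (intro continuous_map_pairedI continuous_map_subtopology_fst)
    then show ?thesis
      using continuous_map_compose_fun[OF _ c[unfolded case_prod_unfold]] by fastforce
  qed
  have "continuous_map ?P X (\<lambda>z. if snd z \<le> 1/2 then a (fst z) (2 * snd z) else b (fst z) (2 * snd z - 1))"
  proof (intro continuous_map_cases_le snd)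
    show "continuous_map (subtopology ?P {z \<in> topspace ?P. snd z \<le> 1/2}) X (\<lambda>z. a (fst z) (2 * snd z))"
      using part[OF a, of "{z \<in> topspace ?P. snd z \<le> 1/2}" 2 0] by auto
    show "continuous_map (subtopology ?P {z \<in> topspace ?P. 1/2 \<le> snd z}) X (\<lambda>z. b (fst z) (2 * snd z - 1))"
      using part[OF b, of "{z \<in> topspace ?P. 1/2 \<le> snd z}" 2 "-1"] by auto
    show "a (fst z) (2 * snd z) = b (fst z) (2 * snd z - 1)" if "z \<in> topspace ?P" "snd z = 1/2" for z
      unfolding that(2) using ab[of "fst z"] that(1) by auto
  qed auto
  then show ?thesis
    by (simp add: path_join_def case_prod_unfold)
qed

lemma pathin_join:
  assumes "pathin X \<alpha>" "pathin X \<beta>" "\<alpha> 1 = \<beta> 0"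
  shows "pathin X (\<alpha> \<star> \<beta>)"
proof -
  have c: "continuous_map (prod_topology unit_interval unit_interval) X (\<lambda>(w, t). \<gamma> t)" if "pathin X \<gamma>" for \<gamma>
    unfolding case_prod_unfold
    by (rule continuous_map_compose_fun[OF continuous_map_snd that[unfolded pathin_def]])
  have "continuous_map (prod_topology unit_interval unit_interval) X (\<lambda>(w, t). (\<alpha> \<star> \<beta>) t)"
    by (rule continuous_map_path_join) (use assms c in auto)
  moreover have "continuous_map unit_interval (prod_topology unit_interval unit_interval) (\<lambda>t. (0, t))"
    by (rule continuous_map_pairedI) auto
  ultimately have "continuous_map unit_interval X (\<lambda>t. case (0::real, t) of (w, t) \<Rightarrow> (\<alpha> \<star> \<beta>) t)"
    by (rule continuous_map_compose_fun[rotated])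
  then show ?thesis
    by (simp add: pathin_def)
qed

lemma path_join_ends [simp]: "(\<alpha> \<star> \<beta>) 0 = \<alpha> 0" "(\<alpha> \<star> \<beta>) 1 = \<beta> 1"
  by (simp_all add: path_join_def)

lemma path_join_second_half:
  assumes "\<alpha> 1 = \<beta> 0" "1/2 \<le> s"
  shows "(\<alpha> \<star> \<beta>) s = \<beta> (2 * s - 1)"
proof (cases "s = 1/2")
  case True
  show ?thesis unfolding True using assms(1) by (simp add: path_join_def)
next
  case False
  with assms(2) have "\<not> s \<le> 1/2" by linarith
  then show ?thesis by (simp add: path_join_def)
qed

lemma path_reverse_ends [simp]: "path_reverse \<alpha> 0 = \<alpha> 1" "path_reverse \<alpha> 1 = \<alpha> 0"
  by (simp_all add: path_reverse_def)

lemma path_reverse_reverse [simp]: "path_reverse (path_reverse \<alpha>) = \<alpha>"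
  by (simp add: path_reverse_def)

lemma path_reverse_join:
  assumes "\<alpha> 1 = \<beta> 0"
  shows "path_reverse (\<alpha> \<star> \<beta>) = path_reverse \<beta> \<star> path_reverse \<alpha>"
proof
  fix t :: real
  consider "t < 1/2" | "t = 1/2" | "t > 1/2" by linarith
  then show "path_reverse (\<alpha> \<star> \<beta>) t = (path_reverse \<beta> \<star> path_reverse \<alpha>) t"
    by cases (use assms in \<open>auto simp: path_reverse_def path_join_def algebra_simps\<close>)
qed

lemma path_join_compose: "(\<lambda>t. f ((a \<star> b) t)) = (\<lambda>t. f (a t)) \<star> (\<lambda>t. f (b t))"
  by (auto simp: path_join_def)

lemma pathin_in_topspace: "pathin X \<alpha> \<Longrightarrow> 0 \<le> t \<Longrightarrow> t \<le> 1 \<Longrightarrow> \<alpha> t \<in> topspace X"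
  unfolding pathin_def continuous_map_def by auto

lemma pathin_unit_intervalI:
  "continuous_on {0..1} r \<Longrightarrow> (\<And>t. 0 \<le> t \<Longrightarrow> t \<le> 1 \<Longrightarrow> 0 \<le> r t \<and> r t \<le> 1) \<Longrightarrow> pathin unit_interval r"
  by (auto simp: pathin_canon_iff path_def)

lemma pathin_reparametrize:
  assumes "pathin X \<alpha>" "pathin unit_interval r"
  shows "pathin X (\<lambda>t. \<alpha> (r t))"
  using assms unfolding pathin_def by (rule continuous_map_compose_fun[rotated])

lemma pathin_reverse: "pathin X \<alpha> \<Longrightarrow> pathin X (path_reverse \<alpha>)"
  unfolding path_reverse_def by (rule pathin_reparametrize) (auto intro!: pathin_unit_intervalI continuous_intros)

lemma path_homotopic_reparametrize:
  assumes "pathin X \<alpha>" "pathin unit_interval r" "pathin unit_interval s"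
    and "r 0 = s 0" "r 1 = s 1"
  shows "path_homotopic X (\<lambda>t. \<alpha> (r t)) (\<lambda>t. \<alpha> (s t))"
  using assms unfolding pathin_def[of X]
  by (intro path_homotopic_equiconnected[OF equiconnecting_convex[of "{0..1}"]]) simp_all

lemma path_homotopic_join:
  assumes "path_homotopic X \<alpha> \<alpha>'" "path_homotopic X \<beta> \<beta>'" "\<alpha> 1 = \<beta> 0"
  shows "path_homotopic X (\<alpha> \<star> \<beta>) (\<alpha>' \<star> \<beta>')"
proof -
  obtain h where h: "continuous_map (prod_topology unit_interval unit_interval) X h"
    "\<And>t. h (0, t) = \<alpha> t" "\<And>t. h (1, t) = \<alpha>' t"
    "\<And>s. s \<in> {0..1} \<Longrightarrow> h (s, 0) = \<alpha> 0" "\<And>s. s \<in> {0..1} \<Longrightarrow> h (s, 1) = \<alpha> 1"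
    using path_homotopicE[OF assms(1)] by blast
  obtain k where k: "continuous_map (prod_topology unit_interval unit_interval) X k"
    "\<And>t. k (0, t) = \<beta> t" "\<And>t. k (1, t) = \<beta>' t"
    "\<And>s. s \<in> {0..1} \<Longrightarrow> k (s, 0) = \<beta> 0" "\<And>s. s \<in> {0..1} \<Longrightarrow> k (s, 1) = \<beta> 1"
    using path_homotopicE[OF assms(2)] by blast
  show ?thesis
  proof (rule path_homotopicI)
    show "continuous_map (prod_topology unit_interval unit_interval) X
        (\<lambda>(s, t). ((\<lambda>t. h (s, t)) \<star> (\<lambda>t. k (s, t))) t)"
      by (rule continuous_map_path_join) (use h k assms(3) in auto)
  qed (use h k in \<open>auto simp: path_join_def\<close>)
qed

lemma path_homotopic_join_const:
  assumes "pathin X \<alpha>"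
  shows "path_homotopic X (\<alpha> \<star> (\<lambda>_. \<alpha> 1)) \<alpha>"
proof -
  have "path_homotopic X (\<lambda>t. \<alpha> (((\<lambda>t. t) \<star> (\<lambda>_. 1)) t)) (\<lambda>t. \<alpha> t)"
    by (intro path_homotopic_reparametrize[OF assms] pathin_join pathin_unit_intervalI)
      (auto intro!: continuous_intros)
  then show ?thesis by (simp only: path_join_compose)
qed

lemma path_homotopic_const_join:
  assumes "pathin X \<alpha>"
  shows "path_homotopic X ((\<lambda>_. \<alpha> 0) \<star> \<alpha>) \<alpha>"
proof -
  have "path_homotopic X (\<lambda>t. \<alpha> (((\<lambda>_. 0) \<star> (\<lambda>t. t)) t)) (\<lambda>t. \<alpha> t)"
    by (intro path_homotopic_reparametrize[OF assms] pathin_join pathin_unit_intervalI)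
      (auto intro!: continuous_intros)
  then show ?thesis by (simp only: path_join_compose)
qed

lemma path_homotopic_join_reverse:
  assumes "pathin X \<alpha>"
  shows "path_homotopic X (\<alpha> \<star> path_reverse \<alpha>) (\<lambda>_. \<alpha> 0)"
proof -
  have "path_homotopic X (\<lambda>t. \<alpha> (((\<lambda>t. t) \<star> (\<lambda>t. 1 - t)) t)) (\<lambda>t. \<alpha> ((\<lambda>_. 0) t))"
    by (intro path_homotopic_reparametrize[OF assms] pathin_join pathin_unit_intervalI)
      (auto intro!: continuous_intros)
  then show ?thesis by (simp only: path_join_compose path_reverse_def)
qed

lemma path_homotopic_reverse_join:
  assumes "pathin X \<alpha>"
  shows "path_homotopic X (path_reverse \<alpha> \<star> \<alpha>) (\<lambda>_. \<alpha> 1)"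
  using path_homotopic_join_reverse[OF pathin_reverse[OF assms]] by simp

text \<open>
  The two bracketings are the same path run at different speeds: a piecewise linear change of
  parameter carries the quarters and half of the left side to the half and quarters of the right.
\<close>

lemma path_homotopic_assoc:
  assumes "pathin X \<alpha>" "pathin X \<beta>" "pathin X \<gamma>" "\<alpha> 1 = \<beta> 0" "\<beta> 1 = \<gamma> 0"
  shows "path_homotopic X ((\<alpha> \<star> \<beta>) \<star> \<gamma>) (\<alpha> \<star> (\<beta> \<star> \<gamma>))"
proof -
  let ?F = "\<alpha> \<star> (\<beta> \<star> \<gamma>)"
  let ?r = "((\<lambda>t. t / 2) \<star> (\<lambda>t. 1/2 + t / 4)) \<star> (\<lambda>t::real. 3/4 + t / 4)"
  have pF: "pathin X ?F"
    by (intro pathin_join) (use assms in auto)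
  have "path_homotopic X (\<lambda>t. ?F (?r t)) (\<lambda>t. ?F t)"
    by (intro path_homotopic_reparametrize[OF pF] pathin_join pathin_unit_intervalI)
      (auto intro!: continuous_intros)
  moreover have "?F (?r t) = ((\<alpha> \<star> \<beta>) \<star> \<gamma>) t" for t
  proof -
    consider "t \<le> 1/4" | "1/4 < t" "t \<le> 1/2" | "t > 1/2" by linarith
    then show ?thesis
    proof cases
      case 1
      then show ?thesis by (simp add: path_join_def)
    next
      case 2
      have "(16 * t - 4) / 4 = 4 * t - 1"
        by (simp add: field_simps)
      with 2 show ?thesis by (simp add: path_join_def algebra_simps diff_divide_distrib)
    next
      case 3
      have "(8 * t - 4) / 4 = 2 * t - 1"
        by (simp add: field_simps)
      with 3 show ?thesis by (simp add: path_join_def algebra_simps diff_divide_distrib)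
    qed
  qed
  ultimately show ?thesis by simp
qed

text \<open>
  This cancellation is the single computation behind both the transitivity of \<open>H\<close>-equivalence
  and its invariance under prolonging paths.
\<close>

lemma path_homotopic_cancel:
  assumes "pathin X \<alpha>" "pathin X \<gamma>" "pathin X \<delta>" "\<alpha> 1 = \<gamma> 0" "\<delta> 0 = \<gamma> 0"
  shows "path_homotopic X ((\<alpha> \<star> \<gamma>) \<star> (path_reverse \<gamma> \<star> \<delta>)) (\<alpha> \<star> \<delta>)"
proof -
  note p = pathin_join pathin_reverse assms path_homotopic_refl
  have "path_homotopic X ((\<alpha> \<star> \<gamma>) \<star> (path_reverse \<gamma> \<star> \<delta>)) (\<alpha> \<star> (\<gamma> \<star> (path_reverse \<gamma> \<star> \<delta>)))"
    by (intro path_homotopic_assoc) (simp_all add: p)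
  also have "path_homotopic X \<dots> (\<alpha> \<star> ((\<gamma> \<star> path_reverse \<gamma>) \<star> \<delta>))"
    by (intro path_homotopic_join path_homotopic_sym[OF path_homotopic_assoc]) (simp_all add: p)
  also have "path_homotopic X \<dots> (\<alpha> \<star> ((\<lambda>_. \<delta> 0) \<star> \<delta>))"
    using path_homotopic_join_reverse[OF assms(2)] 
    by (intro path_homotopic_join) (simp_all add: p)
  also have "path_homotopic X \<dots> (\<alpha> \<star> \<delta>)"
    by (intro path_homotopic_join path_homotopic_const_join) (simp_all add: p)
  finally show ?thesis .
qed


section \<open>The fundamental group\<close>

abbreviation loops :: "'a topology \<Rightarrow> 'a \<Rightarrow> (real \<Rightarrow> 'a) set"
  where "loops X x\<^sub>0 \<equiv> {\<alpha>. pathin X \<alpha> \<and> \<alpha> 0 = x\<^sub>0 \<and> \<alpha> 1 = x\<^sub>0}"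

lemma path_class_eqI:
  assumes "path_homotopic X \<alpha> \<beta>"
  shows "path_class X \<alpha> = path_class X \<beta>"
  unfolding path_class_def
  using path_homotopic_trans[OF assms] path_homotopic_trans[OF path_homotopic_sym[OF assms]] by auto

lemma mult_fundamental_group:
  assumes "\<alpha> \<in> loops X x\<^sub>0" "\<beta> \<in> loops X x\<^sub>0"
  shows "path_class X \<alpha> \<otimes>\<^bsub>fundamental_group X x\<^sub>0\<^esub> path_class X \<beta> = path_class X (\<alpha> \<star> \<beta>)"
proof -
  have "path_class X (\<alpha>' \<star> \<beta>') = path_class X (\<alpha> \<star> \<beta>)"
    if "\<alpha>' \<in> path_class X \<alpha>" "\<beta>' \<in> path_class X \<beta>" for \<alpha>' \<beta>'
    using that assms unfolding path_class_def[of X \<alpha>] path_class_def[of X \<beta>]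
    by (intro path_class_eqI path_homotopic_sym[OF path_homotopic_join]) auto
  then have "(\<Union>\<alpha>'\<in>path_class X \<alpha>. \<Union>\<beta>'\<in>path_class X \<beta>. path_class X (\<alpha>' \<star> \<beta>')) =
      (\<Union>\<alpha>'\<in>path_class X \<alpha>. \<Union>\<beta>'\<in>path_class X \<beta>. path_class X (\<alpha> \<star> \<beta>))"
    by (intro SUP_cong refl)
  moreover have "path_class X \<alpha> \<noteq> {}" "path_class X \<beta> \<noteq> {}"
    using assms path_homotopic_refl[of X \<alpha>] path_homotopic_refl[of X \<beta>] unfolding path_class_def by auto
  ultimately show ?thesis
    by (simp add: fundamental_group_def)
qed

lemma one_fundamental_group: "\<one>\<^bsub>fundamental_group X x\<^sub>0\<^esub> = path_class X (\<lambda>_. x\<^sub>0)"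
  by (simp add: fundamental_group_def)

lemma carrier_fundamental_group: "carrier (fundamental_group X x\<^sub>0) = path_class X ` loops X x\<^sub>0"
  by (simp add: fundamental_group_def)

lemma join_in_loops: "\<alpha> \<in> loops X x\<^sub>0 \<Longrightarrow> \<beta> \<in> loops X x\<^sub>0 \<Longrightarrow> \<alpha> \<star> \<beta> \<in> loops X x\<^sub>0"
  by (simp add: pathin_join)

lemma reverse_in_loops: "\<alpha> \<in> loops X x\<^sub>0 \<Longrightarrow> path_reverse \<alpha> \<in> loops X x\<^sub>0"
  by (simp add: pathin_reverse)

lemma const_in_loops: "x\<^sub>0 \<in> topspace X \<Longrightarrow> (\<lambda>_. x\<^sub>0) \<in> loops X x\<^sub>0"
  by simp

lemma reverse_mult_fundamental_group:
  assumes "\<alpha> \<in> loops X x\<^sub>0"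
  shows "path_class X (path_reverse \<alpha>) \<otimes>\<^bsub>fundamental_group X x\<^sub>0\<^esub> path_class X \<alpha> =
         \<one>\<^bsub>fundamental_group X x\<^sub>0\<^esub>"
  using path_class_eqI[OF path_homotopic_reverse_join[of X \<alpha>]] assms
    mult_fundamental_group[OF reverse_in_loops[OF assms] assms]
  by (simp add: one_fundamental_group)

text \<open>
  The group structure serves to identify the inverse occurring in the definition of a subgroup with
  the class of the reversed loop.
\<close>

lemma group_fundamental_group:
  assumes "x\<^sub>0 \<in> topspace X"
  shows "group (fundamental_group X x\<^sub>0)"
proof (rule groupI; unfold carrier_fundamental_group)
  let ?G = "fundamental_group X x\<^sub>0"
  show "\<one>\<^bsub>?G\<^esub> \<in> path_class X ` loops X x\<^sub>0"
    unfolding one_fundamental_group by (rule imageI, rule const_in_loops[OF assms])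
next
  let ?G = "fundamental_group X x\<^sub>0"
  fix a assume "a \<in> path_class X ` loops X x\<^sub>0"
  then obtain \<alpha> where a: "a = path_class X \<alpha>" "\<alpha> \<in> loops X x\<^sub>0" by blast
  show "\<one>\<^bsub>?G\<^esub> \<otimes>\<^bsub>?G\<^esub> a = a"
    using path_class_eqI[OF path_homotopic_const_join[of X \<alpha>]] a(2)
      mult_fundamental_group[OF const_in_loops[OF assms] a(2)]
    by (simp add: a(1) one_fundamental_group)
  show "\<exists>b\<in>path_class X ` loops X x\<^sub>0. b \<otimes>\<^bsub>?G\<^esub> a = \<one>\<^bsub>?G\<^esub>"
    using reverse_mult_fundamental_group[OF a(2)] reverse_in_loops[OF a(2)] a(1) by blast
  fix b assume "b \<in> path_class X ` loops X x\<^sub>0"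
  then obtain \<beta> where b: "b = path_class X \<beta>" "\<beta> \<in> loops X x\<^sub>0" by blast
  show "a \<otimes>\<^bsub>?G\<^esub> b \<in> path_class X ` loops X x\<^sub>0"
    unfolding a(1) b(1) mult_fundamental_group[OF a(2) b(2)] using join_in_loops[OF a(2) b(2)] by (rule imageI)
  fix c assume "c \<in> path_class X ` loops X x\<^sub>0"
  then obtain \<gamma> where c: "c = path_class X \<gamma>" "\<gamma> \<in> loops X x\<^sub>0" by blast
  show "a \<otimes>\<^bsub>?G\<^esub> b \<otimes>\<^bsub>?G\<^esub> c = a \<otimes>\<^bsub>?G\<^esub> (b \<otimes>\<^bsub>?G\<^esub> c)"
    unfolding a(1) b(1) c(1) mult_fundamental_group[OF a(2) b(2)] mult_fundamental_group[OF b(2) c(2)]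
      mult_fundamental_group[OF join_in_loops[OF a(2) b(2)] c(2)]
      mult_fundamental_group[OF a(2) join_in_loops[OF b(2) c(2)]]
    using a(2) b(2) c(2) by (intro path_class_eqI path_homotopic_assoc) simp_all
qed

lemma inv_fundamental_group:
  assumes "x\<^sub>0 \<in> topspace X" "\<alpha> \<in> loops X x\<^sub>0"
  shows "inv\<^bsub>fundamental_group X x\<^sub>0\<^esub> path_class X \<alpha> = path_class X (path_reverse \<alpha>)"
  by (rule group.inv_equality[OF group_fundamental_group[OF assms(1)] reverse_mult_fundamental_group[OF assms(2)]];
      unfold carrier_fundamental_group; rule imageI)
    (rule assms(2) reverse_in_loops[OF assms(2)])+


section \<open>\<open>H\<close>-equivalence of paths\<close>

locale path_subgroup =
  fixes X :: "'a topology" and x\<^sub>0 :: 'a and H :: "(real \<Rightarrow> 'a) set set"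
  assumes base_in: "x\<^sub>0 \<in> topspace X" and subgroup: "subgroup H (fundamental_group X x\<^sub>0)"
begin

abbreviation P where "P \<equiv> based_paths X x\<^sub>0"
abbreviation cls where "cls \<equiv> hat_class X x\<^sub>0 H"
abbreviation nbhd where "nbhd \<equiv> hat_nbhd X x\<^sub>0 H"
abbreviation XH where "XH \<equiv> hat_space X x\<^sub>0 H"
abbreviation base where "base \<equiv> hat_base X x\<^sub>0 H"

text \<open>
  The relation in predicate form, so that it can be chained in calculations.
\<close>

definition equivalent :: "(real \<Rightarrow> 'a) \<Rightarrow> (real \<Rightarrow> 'a) \<Rightarrow> bool" (infix \<open>\<sim>\<^sub>H\<close> 50)
  where "\<alpha> \<sim>\<^sub>H \<beta> \<longleftrightarrow> (\<alpha>, \<beta>) \<in> hat_rel X x\<^sub>0 H"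

lemma P_iff: "\<alpha> \<in> P \<longleftrightarrow> pathin X \<alpha> \<and> \<alpha> 0 = x\<^sub>0"
  by (simp add: based_paths_def)

lemma join_in_P: "\<alpha> \<in> P \<Longrightarrow> pathin X \<gamma> \<Longrightarrow> \<gamma> 0 = \<alpha> 1 \<Longrightarrow> \<alpha> \<star> \<gamma> \<in> P"
  by (simp add: P_iff pathin_join)

lemma equivalentD:
  assumes "\<alpha> \<sim>\<^sub>H \<beta>"
  shows "\<alpha> \<in> P" "\<beta> \<in> P" "\<alpha> 1 = \<beta> 1" "path_class X (\<alpha> \<star> path_reverse \<beta>) \<in> H"
  using assms by (auto simp: equivalent_def hat_rel_def)

lemma equivalent_iff:
  assumes "\<alpha> \<in> P" "\<beta> \<in> P" "\<alpha> 1 = \<beta> 1"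
  shows "\<alpha> \<sim>\<^sub>H \<beta> \<longleftrightarrow> path_class X (\<alpha> \<star> path_reverse \<beta>) \<in> H"
  using assms by (auto simp: equivalent_def hat_rel_def)

lemma loop_of_pair: "\<alpha> \<in> P \<Longrightarrow> \<beta> \<in> P \<Longrightarrow> \<alpha> 1 = \<beta> 1 \<Longrightarrow> \<alpha> \<star> path_reverse \<beta> \<in> loops X x\<^sub>0"
  by (simp add: P_iff pathin_join pathin_reverse)

lemma homotopic_in_H: "path_class X \<alpha> \<in> H \<Longrightarrow> path_homotopic X \<alpha> \<beta> \<Longrightarrow> path_class X \<beta> \<in> H"
  using path_class_eqI[of X \<alpha> \<beta>] by simp

lemma const_in_H: "path_class X (\<lambda>_. x\<^sub>0) \<in> H"
  using subgroup.one_closed[OF subgroup] by (simp add: one_fundamental_group)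

lemma join_in_H:
  "\<alpha> \<in> loops X x\<^sub>0 \<Longrightarrow> \<beta> \<in> loops X x\<^sub>0 \<Longrightarrow> path_class X \<alpha> \<in> H \<Longrightarrow> path_class X \<beta> \<in> H \<Longrightarrow>
    path_class X (\<alpha> \<star> \<beta>) \<in> H"
  using subgroup.m_closed[OF subgroup, of "path_class X \<alpha>" "path_class X \<beta>"]
    mult_fundamental_group[of \<alpha> X x\<^sub>0 \<beta>] by simp

lemma reverse_in_H:
  "\<alpha> \<in> loops X x\<^sub>0 \<Longrightarrow> path_class X \<alpha> \<in> H \<Longrightarrow> path_class X (path_reverse \<alpha>) \<in> H"
  using subgroup.m_inv_closed[OF subgroup, of "path_class X \<alpha>"] inv_fundamental_group[OF base_in, of \<alpha>]
  by simp

lemma homotopic_in_P: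
  assumes "\<alpha> \<in> P" "path_homotopic X \<alpha> \<beta>"
  shows "\<beta> \<in> P"
  using assms(1) path_homotopic_imp_pathin(2)[OF assms(2)] path_homotopic_ends(1)[OF assms(2)]
  by (simp add: P_iff)

text \<open>
  With \<open>\<beta>\<close> homotopic to \<open>\<alpha>\<close>, the loop \<open>\<alpha> \<star> path_reverse \<beta>\<close> is homotopic to
  \<open>\<beta> \<star> path_reverse \<beta>\<close>, hence null-homotopic.
\<close>

lemma homotopic_imp_equivalent:
  assumes "\<alpha> \<in> P" "path_homotopic X \<alpha> \<beta>"
  shows "\<alpha> \<sim>\<^sub>H \<beta>"
proof -
  note \<beta> = homotopic_in_P[OF assms] path_homotopic_ends[OF assms(2)]
  have "path_homotopic X (\<beta> \<star> path_reverse \<beta>) (\<alpha> \<star> path_reverse \<beta>)"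
    by (rule path_homotopic_join[OF path_homotopic_sym[OF assms(2)] path_homotopic_refl])
      (use \<beta> in \<open>simp_all add: P_iff pathin_reverse\<close>)
  moreover have "path_homotopic X (\<lambda>_. x\<^sub>0) (\<beta> \<star> path_reverse \<beta>)"
    using \<beta> path_homotopic_sym[OF path_homotopic_join_reverse[of X \<beta>]] by (simp add: P_iff)
  ultimately have "path_class X (\<alpha> \<star> path_reverse \<beta>) \<in> H"
    by (metis homotopic_in_H const_in_H)
  then show ?thesis
    using assms \<beta> by (simp add: equivalent_iff)
qed

lemma equivalent_refl: "\<alpha> \<in> P \<Longrightarrow> \<alpha> \<sim>\<^sub>H \<alpha>"
  by (simp add: homotopic_imp_equivalent P_iff path_homotopic_refl)

lemma equivalent_sym:
  assumes "\<alpha> \<sim>\<^sub>H \<beta>"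
  shows "\<beta> \<sim>\<^sub>H \<alpha>"
proof -
  note d = equivalentD[OF assms]
  have "path_class X (path_reverse (\<alpha> \<star> path_reverse \<beta>)) \<in> H"
    using d by (intro reverse_in_H loop_of_pair)
  then show ?thesis
    using d by (simp add: equivalent_iff path_reverse_join)
qed

lemma equivalent_trans [trans]:
  assumes "\<alpha> \<sim>\<^sub>H \<beta>" "\<beta> \<sim>\<^sub>H \<gamma>"
  shows "\<alpha> \<sim>\<^sub>H \<gamma>"
proof -
  note d = equivalentD[OF assms(1)] equivalentD[OF assms(2)]
  have "path_class X ((\<alpha> \<star> path_reverse \<beta>) \<star> (\<beta> \<star> path_reverse \<gamma>)) \<in> H"
    by (rule join_in_H[OF loop_of_pair loop_of_pair]) (use d in simp_all)
  moreover have "path_homotopic X ((\<alpha> \<star> path_reverse \<beta>) \<star> (\<beta> \<star> path_reverse \<gamma>)) (\<alpha> \<star> path_reverse \<gamma>)"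
    using path_homotopic_cancel[of X \<alpha> "path_reverse \<beta>" "path_reverse \<gamma>"] d
    by (simp add: P_iff pathin_reverse)
  ultimately show ?thesis
    using d homotopic_in_H[of "(\<alpha> \<star> path_reverse \<beta>) \<star> (\<beta> \<star> path_reverse \<gamma>)"]
    by (simp add: equivalent_iff)
qed

lemma equivalent_join:
  assumes "\<alpha> \<sim>\<^sub>H \<beta>" "pathin X \<gamma>" "\<gamma> 0 = \<alpha> 1"
  shows "\<alpha> \<star> \<gamma> \<sim>\<^sub>H \<beta> \<star> \<gamma>"
proof -
  note d = equivalentD[OF assms(1)]
  have "path_homotopic X ((\<alpha> \<star> \<gamma>) \<star> (path_reverse \<gamma> \<star> path_reverse \<beta>)) (\<alpha> \<star> path_reverse \<beta>)"
    by (rule path_homotopic_cancel) (use d assms in \<open>simp_all add: P_iff pathin_reverse\<close>)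
  then have "path_class X ((\<alpha> \<star> \<gamma>) \<star> (path_reverse \<gamma> \<star> path_reverse \<beta>)) \<in> H"
    by (rule homotopic_in_H[OF d(4) path_homotopic_sym])
  then show ?thesis
    using d assms by (simp add: equivalent_iff join_in_P path_reverse_join)
qed

lemma cls_eq: "cls \<alpha> = {\<beta>. \<alpha> \<sim>\<^sub>H \<beta>}"
  by (auto simp: hat_class_def equivalent_def)

lemma cls_eq_iff:
  assumes "\<alpha> \<in> P" "\<beta> \<in> P"
  shows "cls \<alpha> = cls \<beta> \<longleftrightarrow> \<alpha> \<sim>\<^sub>H \<beta>"
proof
  assume "cls \<alpha> = cls \<beta>"
  then show "\<alpha> \<sim>\<^sub>H \<beta>"
    using equivalent_refl[OF assms(2)] by (auto simp: cls_eq)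
next
  assume "\<alpha> \<sim>\<^sub>H \<beta>"
  then show "cls \<alpha> = cls \<beta>"
    unfolding cls_eq using equivalent_trans[of \<alpha> \<beta>] equivalent_trans[of \<beta> \<alpha>] equivalent_sym[of \<alpha> \<beta>]
    by auto
qed

lemma hat_proj_cls:
  assumes "\<alpha> \<in> P"
  shows "hat_proj (cls \<alpha>) = \<alpha> 1"
proof -
  have "(\<lambda>\<beta>. \<beta> 1) ` cls \<alpha> = (\<lambda>_. \<alpha> 1) ` cls \<alpha>"
    by (intro image_cong refl) (simp add: cls_eq equivalentD(3)[symmetric])
  also have "\<dots> = {\<alpha> 1}"
    using equivalent_refl[OF assms] by (intro image_constant) (simp add: cls_eq)
  finally show ?thesis
    by (simp add: hat_proj_def)
qed

lemma nbhd_eq_cls: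
  "nbhd \<alpha> U = {cls \<beta> | \<beta>. \<beta> \<in> P \<and>
     (\<exists>\<gamma>. pathin (subtopology X U) \<gamma> \<and> \<gamma> 0 = \<alpha> 1 \<and> \<gamma> 1 = \<beta> 1 \<and> \<beta> \<sim>\<^sub>H \<alpha> \<star> \<gamma>)}"
  by (simp add: hat_nbhd_def equivalent_def)

lemma cls_in_nbhd_iff:
  assumes "\<delta> \<in> P"
  shows "cls \<delta> \<in> nbhd \<alpha> U \<longleftrightarrow>
    (\<exists>\<gamma>. pathin (subtopology X U) \<gamma> \<and> \<gamma> 0 = \<alpha> 1 \<and> \<gamma> 1 = \<delta> 1 \<and> \<delta> \<sim>\<^sub>H \<alpha> \<star> \<gamma>)"
proof
  assume "cls \<delta> \<in> nbhd \<alpha> U"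
  then obtain \<beta> \<gamma> where "cls \<delta> = cls \<beta>" "\<beta> \<in> P" and \<gamma>: "pathin (subtopology X U) \<gamma>" "\<gamma> 0 = \<alpha> 1" "\<gamma> 1 = \<beta> 1"
    and "\<beta> \<sim>\<^sub>H \<alpha> \<star> \<gamma>"
    unfolding nbhd_eq_cls by blast
  then have "\<delta> \<sim>\<^sub>H \<beta>"
    using cls_eq_iff assms by blast
  then have "\<delta> \<sim>\<^sub>H \<alpha> \<star> \<gamma>" "\<gamma> 1 = \<delta> 1"
    using equivalent_trans[OF _ \<open>\<beta> \<sim>\<^sub>H \<alpha> \<star> \<gamma>\<close>] equivalentD(3)[OF \<open>\<delta> \<sim>\<^sub>H \<beta>\<close>] \<gamma>(3) by simp_all
  with \<gamma> show "\<exists>\<gamma>. pathin (subtopology X U) \<gamma> \<and> \<gamma> 0 = \<alpha> 1 \<and> \<gamma> 1 = \<delta> 1 \<and> \<delta> \<sim>\<^sub>H \<alpha> \<star> \<gamma>"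
    by (intro exI[of _ \<gamma>]) simp
next
  assume "\<exists>\<gamma>. pathin (subtopology X U) \<gamma> \<and> \<gamma> 0 = \<alpha> 1 \<and> \<gamma> 1 = \<delta> 1 \<and> \<delta> \<sim>\<^sub>H \<alpha> \<star> \<gamma>"
  with assms show "cls \<delta> \<in> nbhd \<alpha> U"
    unfolding nbhd_eq_cls by blast
qed

lemma nbhd_elim:
  assumes "c \<in> nbhd \<alpha> U"
  obtains \<delta> where "c = cls \<delta>" "\<delta> \<in> P"
  using assms unfolding nbhd_eq_cls by blast

lemma equivalent_const_join:
  assumes "\<alpha> \<in> P"
  shows "\<alpha> \<star> (\<lambda>_. \<alpha> 1) \<sim>\<^sub>H \<alpha>"
proof -
  have "pathin X \<alpha>" "\<alpha> 1 \<in> topspace X"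
    using assms pathin_in_topspace[of X \<alpha> 1] by (auto simp: P_iff)
  then show ?thesis
    using assms by (intro homotopic_imp_equivalent join_in_P path_homotopic_join_const) simp_all
qed

lemma nbhd_self:
  assumes "\<alpha> \<in> P" "\<alpha> 1 \<in> U"
  shows "cls \<alpha> \<in> nbhd \<alpha> U"
proof -
  have "pathin X \<alpha>" "\<alpha> 1 \<in> topspace X"
    using assms pathin_in_topspace[of X \<alpha> 1] by (auto simp: P_iff)
  then have "\<alpha> \<sim>\<^sub>H \<alpha> \<star> (\<lambda>_. \<alpha> 1)" "pathin (subtopology X U) (\<lambda>_. \<alpha> 1)"
    using assms equivalent_sym[OF equivalent_const_join] by simp_all
  then show ?thesis
    unfolding cls_in_nbhd_iff[OF assms(1)] by (intro exI[of _ "\<lambda>_. \<alpha> 1"]) simp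
qed

lemma join_assoc_equivalent:
  assumes "\<alpha> \<in> P" "pathin X \<beta>" "pathin X \<gamma>" "\<beta> 0 = \<alpha> 1" "\<gamma> 0 = \<beta> 1"
  shows "(\<alpha> \<star> \<beta>) \<star> \<gamma> \<sim>\<^sub>H \<alpha> \<star> (\<beta> \<star> \<gamma>)"
  by (intro homotopic_imp_equivalent join_in_P path_homotopic_assoc) (use assms in \<open>simp_all add: P_iff\<close>)

lemma join_homotopic_equivalent:
  assumes "\<alpha> \<in> P" "path_homotopic X \<beta> \<gamma>" "\<beta> 0 = \<alpha> 1"
  shows "\<alpha> \<star> \<beta> \<sim>\<^sub>H \<alpha> \<star> \<gamma>"
  using assms path_homotopic_imp_pathin[OF assms(2)]
  by (intro homotopic_imp_equivalent join_in_P path_homotopic_join) (simp_all add: P_iff path_homotopic_refl)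

text \<open>
  For a fixed set \<open>U\<close>, lying in \<open>nbhd \<alpha> U\<close> is an equivalence relation on the classes of
  paths that end in \<open>U\<close>: connecting paths in \<open>U\<close> may be concatenated and reversed. So these sets are
  either equal or disjoint.
\<close>

lemma nbhd_trans:
  assumes "\<alpha> \<in> P" "\<beta> \<in> P" "cls \<beta> \<in> nbhd \<alpha> U" "c \<in> nbhd \<beta> U"
  shows "c \<in> nbhd \<alpha> U"
proof -
  obtain \<delta> where \<delta>: "c = cls \<delta>" "\<delta> \<in> P"
    using assms(4) by (rule nbhd_elim)
  obtain \<gamma> where \<gamma>: "pathin (subtopology X U) \<gamma>" "\<gamma> 0 = \<alpha> 1" "\<gamma> 1 = \<beta> 1" "\<beta> \<sim>\<^sub>H \<alpha> \<star> \<gamma>"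
    using assms(3) unfolding cls_in_nbhd_iff[OF assms(2)] by blast
  obtain \<eta> where \<eta>: "pathin (subtopology X U) \<eta>" "\<eta> 0 = \<beta> 1" "\<eta> 1 = \<delta> 1" "\<delta> \<sim>\<^sub>H \<beta> \<star> \<eta>"
    using assms(4) unfolding \<delta>(1) cls_in_nbhd_iff[OF \<delta>(2)] by blast
  have p: "pathin X \<gamma>" "pathin X \<eta>"
    using \<gamma>(1) \<eta>(1) by (simp_all add: pathin_subtopology)
  note \<eta>(4)
  also have "\<beta> \<star> \<eta> \<sim>\<^sub>H (\<alpha> \<star> \<gamma>) \<star> \<eta>"
    using \<gamma>(4) p(2) \<eta>(2) by (rule equivalent_join)
  also have "\<dots> \<sim>\<^sub>H \<alpha> \<star> (\<gamma> \<star> \<eta>)"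
    using assms(1) p \<gamma> \<eta> by (intro join_assoc_equivalent) simp_all
  finally show ?thesis
    unfolding \<delta>(1) cls_in_nbhd_iff[OF \<delta>(2)] using \<gamma> \<eta>
    by (intro exI[of _ "\<gamma> \<star> \<eta>"]) (simp add: pathin_join)
qed

lemma nbhd_sym:
  assumes "\<alpha> \<in> P" "\<beta> \<in> P" "cls \<beta> \<in> nbhd \<alpha> U"
  shows "cls \<alpha> \<in> nbhd \<beta> U"
proof -
  obtain \<gamma> where \<gamma>: "pathin (subtopology X U) \<gamma>" "\<gamma> 0 = \<alpha> 1" "\<gamma> 1 = \<beta> 1" "\<beta> \<sim>\<^sub>H \<alpha> \<star> \<gamma>"
    using assms(3) unfolding cls_in_nbhd_iff[OF assms(2)] by blast
  have p: "pathin X \<gamma>" "pathin X \<alpha>"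
    using \<gamma>(1) assms(1) by (simp_all add: pathin_subtopology P_iff)
  have "\<beta> \<star> path_reverse \<gamma> \<sim>\<^sub>H (\<alpha> \<star> \<gamma>) \<star> path_reverse \<gamma>"
    using \<gamma> p by (intro equivalent_join) (simp_all add: pathin_reverse)
  also have "\<dots> \<sim>\<^sub>H \<alpha> \<star> (\<gamma> \<star> path_reverse \<gamma>)"
    using assms(1) p \<gamma> by (intro join_assoc_equivalent) (simp_all add: pathin_reverse)
  also have "\<dots> \<sim>\<^sub>H \<alpha> \<star> (\<lambda>_. \<alpha> 1)"
    using path_homotopic_join_reverse[OF p(1)] \<gamma>(2) assms(1)
    by (intro join_homotopic_equivalent) simp_all
  also have "\<dots> \<sim>\<^sub>H \<alpha>"
    by (rule equivalent_const_join[OF assms(1)])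
  finally show ?thesis
    unfolding cls_in_nbhd_iff[OF assms(1)] using \<gamma>
    by (intro exI[of _ "path_reverse \<gamma>"]) (simp add: pathin_reverse equivalent_sym)
qed

lemma nbhd_eq:
  assumes "\<alpha> \<in> P" "\<beta> \<in> P" "cls \<beta> \<in> nbhd \<alpha> U"
  shows "nbhd \<beta> U = nbhd \<alpha> U"
  by (intro equalityI subsetI) (fact nbhd_trans[OF assms], fact nbhd_trans[OF assms(2,1) nbhd_sym[OF assms]])

lemma nbhd_proj:
  assumes "\<delta> \<in> P" "cls \<delta> \<in> nbhd \<alpha> U"
  shows "\<delta> 1 \<in> U"
proof -
  obtain \<gamma> where "pathin (subtopology X U) \<gamma>" "\<gamma> 1 = \<delta> 1"
    using assms(2) unfolding cls_in_nbhd_iff[OF assms(1)] by blast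
  then show ?thesis
    using pathin_in_topspace[of "subtopology X U" \<gamma> 1] by simp
qed

lemma nbhd_mono:
  assumes "U \<subseteq> V"
  shows "nbhd \<alpha> U \<subseteq> nbhd \<alpha> V"
proof -
  have "pathin (subtopology X V) \<gamma>" if "pathin (subtopology X U) \<gamma>" for \<gamma>
    using that assms by (auto simp: pathin_subtopology)
  then show ?thesis
    unfolding nbhd_eq_cls by blast
qed


section \<open>The topology of the space of classes\<close>

lemma topspace_XH: "topspace XH = cls ` P"
proof
  show "topspace XH \<subseteq> cls ` P"
    unfolding hat_space_def topology_generated_by_topspace
    by (auto elim: nbhd_elim)
  show "cls ` P \<subseteq> topspace XH"
  proof
    fix c assume "c \<in> cls ` P"
    then obtain \<alpha> where \<alpha>: "c = cls \<alpha>" "\<alpha> \<in> P" by blast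
    then have "\<alpha> 1 \<in> topspace X"
      using pathin_in_topspace[of X \<alpha> 1] by (simp add: P_iff)
    then have "c \<in> nbhd \<alpha> (topspace X)" "openin X (topspace X)"
      using \<alpha> nbhd_self by simp_all
    then show "c \<in> topspace XH"
      unfolding hat_space_def topology_generated_by_topspace
      using \<alpha>(2) \<open>\<alpha> 1 \<in> topspace X\<close> by blast
  qed
qed

lemma openin_nbhd:
  assumes "openin X U" "\<alpha> \<in> P" "\<alpha> 1 \<in> U"
  shows "openin XH (nbhd \<alpha> U)"
  unfolding hat_space_def using assms by (intro topology_generated_by_Basis) blast

text \<open>
  The sets \<open>nbhd \<alpha> U\<close> are introduced as a subbasis. That those centred at a point form
  a neighbourhood basis there follows by recentring a given one at that point (\<open>nbhd_eq\<close>) and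
  intersecting the sets \<open>U\<close>.
\<close>

lemma nbhd_basis:
  assumes "openin XH S" "\<alpha> \<in> P" "cls \<alpha> \<in> S"
  shows "\<exists>U. openin X U \<and> \<alpha> 1 \<in> U \<and> nbhd \<alpha> U \<subseteq> S"
proof -
  have "generate_topology_on {nbhd \<alpha> U | \<alpha> U. openin X U \<and> \<alpha> \<in> P \<and> \<alpha> 1 \<in> U} S"
    using assms(1) unfolding hat_space_def by (rule openin_topology_generated_by)
  then show ?thesis
    using assms(3)
  proof induction
    case Empty
    then show ?case by simp
  next
    case (Int S T)
    then obtain U V where UV: "openin X U" "\<alpha> 1 \<in> U" "nbhd \<alpha> U \<subseteq> S" "openin X V" "\<alpha> 1 \<in> V" "nbhd \<alpha> V \<subseteq> T"
      by blast
    have "nbhd \<alpha> (U \<inter> V) \<subseteq> S \<inter> T"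
      using UV nbhd_mono[of "U \<inter> V" U \<alpha>] nbhd_mono[of "U \<inter> V" V \<alpha>] by auto
    then show ?case
      using UV by (intro exI[of _ "U \<inter> V"]) auto
  next
    case (UN K)
    then obtain S where S: "S \<in> K" "cls \<alpha> \<in> S" by blast
    then obtain U where "openin X U" "\<alpha> 1 \<in> U" "nbhd \<alpha> U \<subseteq> S"
      using UN.IH by blast
    then show ?case
      using S(1) by (intro exI[of _ U]) auto
  next
    case (Basis S)
    then obtain \<beta> U where "S = nbhd \<beta> U" "openin X U" "\<beta> \<in> P" by blast
    then show ?case
      using Basis.prems assms(2) nbhd_proj[of \<alpha> \<beta> U] nbhd_eq[of \<beta> \<alpha> U] by (intro exI[of _ U]) simp
  qed
qed

lemma continuous_map_hat_proj: "continuous_map XH X hat_proj"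
  unfolding continuous_map_def
proof (intro conjI allI impI)
  have "\<alpha> 1 \<in> topspace X" if "\<alpha> \<in> P" for \<alpha>
    using that pathin_in_topspace[of X \<alpha> 1] by (simp add: P_iff)
  then show "hat_proj \<in> topspace XH \<rightarrow> topspace X"
    by (auto simp: topspace_XH hat_proj_cls)
next
  fix U assume U: "openin X U"
  show "openin XH {c \<in> topspace XH. hat_proj c \<in> U}"
  proof (subst openin_subopen, intro ballI)
    fix c assume "c \<in> {c \<in> topspace XH. hat_proj c \<in> U}"
    then obtain \<alpha> where \<alpha>: "c = cls \<alpha>" "\<alpha> \<in> P" "\<alpha> 1 \<in> U"
      by (auto simp: topspace_XH hat_proj_cls)
    have "nbhd \<alpha> U \<subseteq> {c \<in> topspace XH. hat_proj c \<in> U}"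
    proof
      fix d assume d: "d \<in> nbhd \<alpha> U"
      then obtain \<delta> where "d = cls \<delta>" "\<delta> \<in> P" by (rule nbhd_elim)
      with d show "d \<in> {c \<in> topspace XH. hat_proj c \<in> U}"
        using nbhd_proj[of \<delta> \<alpha> U] by (simp add: topspace_XH hat_proj_cls)
    qed
    then show "\<exists>T. openin XH T \<and> c \<in> T \<and> T \<subseteq> {c \<in> topspace XH. hat_proj c \<in> U}"
      using openin_nbhd[OF U \<alpha>(2,3)] nbhd_self[OF \<alpha>(2,3)] \<alpha>(1) by blast
  qed
qed

lemma continuous_map_into_XH:
  assumes "\<And>z. z \<in> topspace Z \<Longrightarrow> f z \<in> P"
    and "\<And>z U. z \<in> topspace Z \<Longrightarrow> openin X U \<Longrightarrow> f z 1 \<in> U \<Longrightarrow>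
      \<exists>N. openin Z N \<and> z \<in> N \<and> (\<forall>w\<in>N. cls (f w) \<in> nbhd (f z) U)"
  shows "continuous_map Z XH (\<lambda>z. cls (f z))"
  unfolding continuous_map_def
proof (intro conjI allI impI)
  show "(\<lambda>z. cls (f z)) \<in> topspace Z \<rightarrow> topspace XH"
    using assms(1) by (simp add: topspace_XH)
next
  fix S assume S: "openin XH S"
  show "openin Z {z \<in> topspace Z. cls (f z) \<in> S}"
  proof (subst openin_subopen, intro ballI)
    fix z assume "z \<in> {z \<in> topspace Z. cls (f z) \<in> S}"
    then have z: "z \<in> topspace Z" "cls (f z) \<in> S" by simp_all
    obtain U where U: "openin X U" "f z 1 \<in> U" "nbhd (f z) U \<subseteq> S"
      using nbhd_basis[OF S assms(1)[OF z(1)] z(2)] by blast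
    obtain N where N: "openin Z N" "z \<in> N" "\<forall>w\<in>N. cls (f w) \<in> nbhd (f z) U"
      using assms(2)[OF z(1) U(1,2)] by blast
    then show "\<exists>T. openin Z T \<and> z \<in> T \<and> T \<subseteq> {z \<in> topspace Z. cls (f z) \<in> S}"
      using U(3) openin_subset[OF N(1)] by (intro exI[of _ N]) auto
  qed
qed

text \<open>
  The lift sends \<open>z\<close> to the class of \<open>\<alpha>\<close> followed by the image of the chosen path from \<open>z0\<close> to \<open>z\<close>.
  For continuity at \<open>z\<close>, the tube lemma gives a neighbourhood of points \<open>w\<close> whose connecting
  path \<open>L z w\<close> is mapped into \<open>U\<close>. Since \<open>L z0 z \<star> L z w\<close> and \<open>L z0 w\<close> have the same ends, they
  have homotopic images, so the value at \<open>w\<close> arises from the value at \<open>z\<close> by prolonging the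
  path inside \<open>U\<close>.
\<close>

lemma equiconnected_lift:
  assumes L: "equiconnecting Z L" and h: "continuous_map Z X h"
    and z0: "z0 \<in> topspace Z" and \<alpha>: "\<alpha> \<in> P" "h z0 = \<alpha> 1"
  defines "f \<equiv> \<lambda>z. \<alpha> \<star> (\<lambda>u. h (L z0 z u))"
  shows "continuous_map Z XH (\<lambda>z. cls (f z))"
    and "cls (f z0) = cls \<alpha>"
    and "\<And>z. z \<in> topspace Z \<Longrightarrow> hat_proj (cls (f z)) = h z"
proof -
  have in_Z: "L z w u \<in> topspace Z" if "z \<in> topspace Z" "w \<in> topspace Z" "0 \<le> u" "u \<le> 1" for z w u
    using pathin_in_topspace[OF equiconnecting_path[OF L that(1,2)] that(3,4)] .
  have l: "pathin X (\<lambda>u. h (L z w u))" if "z \<in> topspace Z" "w \<in> topspace Z" for z w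
    using equiconnecting_path[OF L that] h unfolding pathin_def by (rule continuous_map_compose_fun)
  have f_in_P: "f z \<in> P" if "z \<in> topspace Z" for z
    unfolding f_def using that z0 \<alpha> l equiconnecting_ends[OF L z0 that] by (intro join_in_P) simp_all
  have f_end: "f z 1 = h z" if "z \<in> topspace Z" for z
    using equiconnecting_ends[OF L z0 that] by (simp add: f_def)
  show "\<And>z. z \<in> topspace Z \<Longrightarrow> hat_proj (cls (f z)) = h z"
    by (simp add: hat_proj_cls f_in_P f_end)
  have "path_homotopic X (\<lambda>u. h (L z0 z0 u)) (\<lambda>_. \<alpha> 1)"
    using l[OF z0 z0] by (rule path_homotopic_cong) (simp add: equiconnecting_diagonal[OF L z0] \<alpha>)
  then have "f z0 \<sim>\<^sub>H \<alpha> \<star> (\<lambda>_. \<alpha> 1)"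
    unfolding f_def using \<alpha> equiconnecting_ends[OF L z0 z0] by (intro join_homotopic_equivalent) simp_all
  also have "\<dots> \<sim>\<^sub>H \<alpha>"
    by (rule equivalent_const_join[OF \<alpha>(1)])
  finally show "cls (f z0) = cls \<alpha>"
    using cls_eq_iff[OF f_in_P[OF z0] \<alpha>(1)] by simp
  show "continuous_map Z XH (\<lambda>z. cls (f z))"
  proof (rule continuous_map_into_XH[OF f_in_P])
    fix z U assume z: "z \<in> topspace Z" and U: "openin X U" "f z 1 \<in> U"
    let ?T = "prod_topology Z unit_interval"
    have "continuous_map ?T Z (\<lambda>w. L z (fst w) (snd w))"
      by (intro continuous_map_equiconnecting[OF L] continuous_map_fst continuous_map_snd) (use z in simp)
    then have cont: "continuous_map ?T X (\<lambda>w. h (L z (fst w) (snd w)))"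
      using h by (rule continuous_map_compose_fun)
    define W where "W = {w \<in> topspace ?T. h (L z (fst w) (snd w)) \<in> U}"
    have W: "openin ?T W"
      unfolding W_def by (rule openin_continuous_map_preimage[OF cont U(1)])
    have "{z} \<times> {0..1} \<subseteq> W"
      using z U f_end[OF z] by (auto simp: W_def equiconnecting_diagonal[OF L z])
    moreover have "compactin unit_interval {0..1}"
      by (simp add: compactin_subtopology)
    ultimately have "\<exists>N V. openin Z N \<and> openin unit_interval V \<and> z \<in> N \<and> {0..1} \<subseteq> V \<and> N \<times> V \<subseteq> W"
      by (intro tube_lemma_right[OF W _ z])
    then obtain N V where N: "openin Z N" "z \<in> N" "{0..1} \<subseteq> V" "N \<times> V \<subseteq> W"
      by (elim exE conjE)
    have "cls (f w) \<in> nbhd (f z) U" if w: "w \<in> N" for w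
    proof -
      have wZ: "w \<in> topspace Z"
        using w openin_subset[OF N(1)] by blast
      have in_U: "h (L z w u) \<in> U" if "u \<in> {0..1}" for u
      proof -
        have "(w, u) \<in> N \<times> V"
          using N(3) w that by auto
        with N(4) have "(w, u) \<in> W" ..
        then show ?thesis by (simp add: W_def)
      qed
      have "pathin (subtopology X U) (\<lambda>u. h (L z w u))"
        unfolding pathin_subtopology using l[OF z wZ] in_U by simp
      moreover have "f w \<sim>\<^sub>H f z \<star> (\<lambda>u. h (L z w u))"
      proof -
        \<comment> \<open>both are images of paths in \<open>Z\<close>, where paths with the same ends are homotopic\<close>
        have "path_homotopic X (\<lambda>u. h ((L z0 z \<star> L z w) u)) (\<lambda>u. h (L z0 w u))"
          using z0 z wZ
          by (intro path_homotopic_equiconnected[OF L h] pathin_join equiconnecting_path[OF L])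
            (simp_all add: equiconnecting_ends[OF L])
        then have "path_homotopic X ((\<lambda>u. h (L z0 z u)) \<star> (\<lambda>u. h (L z w u))) (\<lambda>u. h (L z0 w u))"
          unfolding path_join_compose .
        then have "\<alpha> \<star> ((\<lambda>u. h (L z0 z u)) \<star> (\<lambda>u. h (L z w u))) \<sim>\<^sub>H f w"
          unfolding f_def using \<alpha> equiconnecting_ends[OF L z0 z]
          by (intro join_homotopic_equivalent) simp_all
        moreover have "f z \<star> (\<lambda>u. h (L z w u)) \<sim>\<^sub>H \<alpha> \<star> ((\<lambda>u. h (L z0 z u)) \<star> (\<lambda>u. h (L z w u)))"
          unfolding f_def
          using \<alpha> l[OF z0 z] l[OF z wZ] equiconnecting_ends[OF L z0 z] equiconnecting_ends[OF L z wZ]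
          by (intro join_assoc_equivalent) simp_all
        ultimately show ?thesis
          by (rule equivalent_sym[OF equivalent_trans[rotated]])
      qed
      ultimately show ?thesis
        unfolding cls_in_nbhd_iff[OF f_in_P[OF wZ]]
        using f_end z wZ equiconnecting_ends[OF L z wZ]
        by (intro exI[of _ "\<lambda>u. h (L z w u)"]) simp
    qed
    with N(1,2) show "\<exists>N. openin Z N \<and> z \<in> N \<and> (\<forall>w\<in>N. cls (f w) \<in> nbhd (f z) U)"
      by (intro exI[of _ N] conjI ballI)
  qed
qed

text \<open>
  Over the unit interval, with straight connecting paths from 0, the lift of \<open>\<gamma>\<close> sends \<open>t\<close> to the
  class of \<open>\<alpha>\<close> followed by the part of \<open>\<gamma>\<close> up to time \<open>t\<close>.
\<close>

lemma path_lift: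
  assumes "\<alpha> \<in> P" "pathin X \<gamma>" "\<gamma> 0 = \<alpha> 1"
  obtains \<kappa> where "pathin XH \<kappa>" "\<kappa> 0 = cls \<alpha>" "\<kappa> 1 = cls (\<alpha> \<star> \<gamma>)"
    "\<And>t. t \<in> {0..1} \<Longrightarrow> hat_proj (\<kappa> t) = \<gamma> t"
proof -
  let ?k = "\<lambda>t. cls (\<alpha> \<star> (\<lambda>u. \<gamma> ((1 - u) *\<^sub>R 0 + u *\<^sub>R t)))"
  note lift = equiconnected_lift[OF equiconnecting_convex[of "{0..1::real}"] assms(2)[unfolded pathin_def],
      of 0 \<alpha>, simplified pathin_def[symmetric]]
  show thesis
    by (rule that[of ?k]) (use lift assms in \<open>auto simp: pathin_def\<close>)
qed

text \<open>
  A basic set lies in one path component because a path in \<open>U\<close> lifts to a path over \<open>U\<close>. It is also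
  clopen in the preimage of \<open>U\<close>, the complement being the union of the basic sets disjoint from
  it, so no path of the preimage can leave it.
\<close>

lemma path_component_preimage:
  assumes U: "openin X U" and \<alpha>: "\<alpha> \<in> P" "\<alpha> 1 \<in> U"
  shows "path_component_of_set (subtopology XH {c \<in> topspace XH. hat_proj c \<in> U}) (cls \<alpha>) = nbhd \<alpha> U"
    (is "path_component_of_set ?W _ = _")
proof (intro equalityI subsetI)
  fix c assume c: "c \<in> nbhd \<alpha> U"
  then obtain \<delta> where \<delta>: "c = cls \<delta>" "\<delta> \<in> P" by (rule nbhd_elim)
  then obtain \<gamma> where \<gamma>: "pathin (subtopology X U) \<gamma>" "\<gamma> 0 = \<alpha> 1" "\<delta> \<sim>\<^sub>H \<alpha> \<star> \<gamma>"
    using c cls_in_nbhd_iff[OF \<delta>(2)] by blast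
  then have p: "pathin X \<gamma>" "\<And>t. t \<in> {0..1} \<Longrightarrow> \<gamma> t \<in> U"
    by (simp_all add: pathin_subtopology)
  obtain \<kappa> where \<kappa>: "pathin XH \<kappa>" "\<kappa> 0 = cls \<alpha>" "\<kappa> 1 = cls (\<alpha> \<star> \<gamma>)"
    "\<And>t. t \<in> {0..1} \<Longrightarrow> hat_proj (\<kappa> t) = \<gamma> t"
    using path_lift[OF \<alpha>(1) p(1) \<gamma>(2)] by blast
  have "\<kappa> 1 = c"
    using \<kappa>(3) \<delta> \<gamma>(3) cls_eq_iff[OF \<delta>(2) equivalentD(2)[OF \<gamma>(3)]] by simp
  moreover have "pathin ?W \<kappa>"
    unfolding pathin_subtopology using \<kappa>(1,4) p(2) pathin_in_topspace[OF \<kappa>(1)] by simp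
  ultimately show "c \<in> path_component_of_set ?W (cls \<alpha>)"
    unfolding path_component_of_def using \<kappa>(2) by blast
next
  fix c assume "c \<in> path_component_of_set ?W (cls \<alpha>)"
  then obtain g where g: "pathin ?W g" "g 0 = cls \<alpha>" "g 1 = c"
    unfolding path_component_of_def by blast
  have sub: "nbhd \<beta> U \<subseteq> topspace ?W" for \<beta>
  proof
    fix d assume d: "d \<in> nbhd \<beta> U"
    then obtain \<delta> where "d = cls \<delta>" "\<delta> \<in> P" by (rule nbhd_elim)
    with d show "d \<in> topspace ?W"
      using nbhd_proj[of \<delta> \<beta> U] by (simp add: topspace_XH hat_proj_cls)
  qed
  have op: "openin ?W (nbhd \<beta> U)" if "\<beta> \<in> P" "\<beta> 1 \<in> U" for \<beta>
    unfolding openin_subtopology using openin_nbhd[OF U that] sub[of \<beta>] by (intro exI[of _ "nbhd \<beta> U"]) auto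
  \<comment> \<open>two basic sets over the same open set with a common point coincide\<close>
  have "openin ?W (topspace ?W - nbhd \<alpha> U)"
  proof (subst openin_subopen, intro ballI)
    fix d assume d: "d \<in> topspace ?W - nbhd \<alpha> U"
    then obtain \<delta> where \<delta>: "d = cls \<delta>" "\<delta> \<in> P" "\<delta> 1 \<in> U"
      by (auto simp: topspace_XH hat_proj_cls)
    have "nbhd \<delta> U \<inter> nbhd \<alpha> U = {}"
    proof (rule ccontr)
      assume "nbhd \<delta> U \<inter> nbhd \<alpha> U \<noteq> {}"
      then obtain e where e: "e \<in> nbhd \<delta> U" "e \<in> nbhd \<alpha> U" by blast
      then obtain \<epsilon> where \<epsilon>: "e = cls \<epsilon>" "\<epsilon> \<in> P" using nbhd_elim by blast
      have "nbhd \<delta> U = nbhd \<alpha> U"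
        using nbhd_eq[OF \<delta>(2) \<epsilon>(2), of U] nbhd_eq[OF \<alpha>(1) \<epsilon>(2), of U] e \<epsilon>(1) by simp
      then show False
        using nbhd_self[OF \<delta>(2,3)] d \<delta>(1) by simp
    qed
    then show "\<exists>T. openin ?W T \<and> d \<in> T \<and> T \<subseteq> topspace ?W - nbhd \<alpha> U"
      using op[OF \<delta>(2,3)] nbhd_self[OF \<delta>(2,3)] \<delta>(1) sub[of \<delta>] by (intro exI[of _ "nbhd \<delta> U"]) auto
  qed
  then have "closedin ?W (nbhd \<alpha> U)"
    using sub by (simp add: closedin_def)
  then have "g ` {0..1} \<subseteq> nbhd \<alpha> U \<or> disjnt (g ` {0..1}) (nbhd \<alpha> U)"
    using connectedin_clopen_cases[OF connectedin_path_image[OF g(1)]] op[OF \<alpha>] by blast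
  moreover have "g 0 \<in> g ` {0..1}" "g 0 \<in> nbhd \<alpha> U"
    using g(2) nbhd_self[OF \<alpha>] by auto
  ultimately have "g ` {0..1} \<subseteq> nbhd \<alpha> U"
    unfolding disjnt_def by blast
  then show "c \<in> nbhd \<alpha> U"
    using g(3) by auto
qed

lemma Peano_map_hat_proj: "Peano_map XH X hat_proj"
  unfolding Peano_map_def openin_topology_base_unique
proof (intro conjI allI impI continuous_map_hat_proj)
  let ?W = "\<lambda>U. subtopology XH {c \<in> topspace XH. hat_proj c \<in> U}"
  fix C assume "\<exists>U. openin X U \<and> C \<in> path_components_of (?W U)"
  then obtain U c where U: "openin X U" and c: "c \<in> topspace (?W U)" "C = path_component_of_set (?W U) c"
    by (auto simp: path_components_of_def)
  then obtain \<alpha> where \<alpha>: "c = cls \<alpha>" "\<alpha> \<in> P" "\<alpha> 1 \<in> U"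
    by (auto simp: topspace_XH hat_proj_cls)
  then show "openin XH C"
    using path_component_preimage[OF U \<alpha>(2,3)] openin_nbhd[OF U \<alpha>(2,3)] c(2) by simp
next
  let ?W = "\<lambda>U. subtopology XH {c \<in> topspace XH. hat_proj c \<in> U}"
  fix S c assume S: "openin XH S \<and> c \<in> S"
  then obtain \<alpha> where \<alpha>: "c = cls \<alpha>" "\<alpha> \<in> P"
    using openin_subset[of XH S] by (auto simp: topspace_XH)
  obtain U where U: "openin X U" "\<alpha> 1 \<in> U" "nbhd \<alpha> U \<subseteq> S"
    using nbhd_basis[of S \<alpha>] S \<alpha> by blast
  have "cls \<alpha> \<in> topspace (?W U)"
    using \<alpha> U by (simp add: topspace_XH hat_proj_cls)
  then have "nbhd \<alpha> U \<in> path_components_of (?W U)"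
    using path_component_preimage[OF U(1) \<alpha>(2) U(2)] unfolding path_components_of_def by blast
  then show "\<exists>V. (\<exists>U. openin X U \<and> V \<in> path_components_of (?W U)) \<and> c \<in> V \<and> V \<subseteq> S"
    using U \<alpha> nbhd_self[OF \<alpha>(2) U(2)] by blast
qed


section \<open>Unique path lifting\<close>

lemma const_in_P: "(\<lambda>_. x\<^sub>0) \<in> P"
  using base_in by (simp add: P_iff)

lemma base_eq: "base = cls (\<lambda>_. x\<^sub>0)"
  by (simp add: hat_base_def)

lemma path_lift_base:
  assumes "\<alpha> \<in> P"
  obtains \<kappa> where "pathin XH \<kappa>" "\<kappa> 0 = base" "\<kappa> 1 = cls \<alpha>" "\<And>t. t \<in> {0..1} \<Longrightarrow> hat_proj (\<kappa> t) = \<alpha> t"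
proof -
  have a: "pathin X \<alpha>" "\<alpha> 0 = x\<^sub>0"
    using assms by (simp_all add: P_iff)
  obtain \<kappa> where \<kappa>: "pathin XH \<kappa>" "\<kappa> 0 = cls (\<lambda>_. x\<^sub>0)" "\<kappa> 1 = cls ((\<lambda>_. x\<^sub>0) \<star> \<alpha>)"
    "\<And>t. t \<in> {0..1} \<Longrightarrow> hat_proj (\<kappa> t) = \<alpha> t"
    using path_lift[OF const_in_P a] by blast
  have eq: "\<alpha> \<sim>\<^sub>H (\<lambda>_. x\<^sub>0) \<star> \<alpha>"
    using homotopic_imp_equivalent[OF assms path_homotopic_sym[OF path_homotopic_const_join[OF a(1)]]] a(2) by simp
  then have "\<kappa> 1 = cls \<alpha>"
    using \<kappa>(3) cls_eq_iff[OF assms equivalentD(2)[OF eq]] eq by simp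
  then show thesis
    using that \<kappa> base_eq by simp
qed

abbreviation UPL where "UPL \<equiv> unique_path_lifting XH base X x\<^sub>0 hat_proj"

text \<open>
  Prefixing both lifts with one and the same path \<open>\<kappa>\<close> from the base point reduces this to
  uniqueness from the base point.
\<close>

lemma unique_lift_of_path:
  assumes UPL and \<mu>: "pathin XH \<mu>" and \<nu>: "pathin XH \<nu>" and start: "\<mu> 0 = \<nu> 0"
    and proj: "\<And>t. t \<in> {0..1} \<Longrightarrow> hat_proj (\<mu> t) = hat_proj (\<nu> t)"
    and t: "t \<in> {0..1}"
  shows "\<mu> t = \<nu> t"
proof -
  have "\<mu> 0 \<in> topspace XH"
    using pathin_in_topspace[OF \<mu>, of 0] by simp
  then obtain \<alpha> where \<alpha>: "\<mu> 0 = cls \<alpha>" "\<alpha> \<in> P"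
    by (auto simp: topspace_XH)
  obtain \<kappa> where \<kappa>: "pathin XH \<kappa>" "\<kappa> 0 = base" "\<kappa> 1 = \<mu> 0"
    using path_lift_base[OF \<alpha>(2)] \<alpha>(1) by metis
  have eq: "(\<kappa> \<star> \<mu>) s = (\<kappa> \<star> \<nu>) s" if "s \<in> {0..1}" for s
  proof -
    have "hat_proj ((\<kappa> \<star> \<mu>) s) = hat_proj ((\<kappa> \<star> \<nu>) s)" if "s \<in> {0..1}" for s
      using that proj[of "2 * s - 1"] by (simp add: path_join_def)
    moreover have "pathin XH (\<kappa> \<star> \<mu>)" "pathin XH (\<kappa> \<star> \<nu>)"
      using \<kappa> \<mu> \<nu> start by (simp_all add: pathin_join)
    ultimately show ?thesis
      using \<open>UPL\<close> \<kappa>(2) that unfolding unique_path_lifting_def by simp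
  qed
  obtain s where s: "t = 2 * s - 1" "1/2 \<le> s" "s \<le> 1"
    using t by (intro that[of "(1 + t) / 2"]) (auto simp: field_simps)
  have "(\<kappa> \<star> \<mu>) s = \<mu> (2 * s - 1)" "(\<kappa> \<star> \<nu>) s = \<nu> (2 * s - 1)"
    using s(2) \<kappa>(3) start by (simp_all add: path_join_second_half)
  then show ?thesis
    unfolding s(1) using eq[of s] s(2,3) by simp
qed

lemma unique_lift_of_map:
  assumes UPL and Z: "path_connected_space Z"
    and f: "continuous_map Z XH f" and g: "continuous_map Z XH g"
    and proj: "\<And>z. z \<in> topspace Z \<Longrightarrow> hat_proj (f z) = hat_proj (g z)"
    and z0: "z0 \<in> topspace Z" "f z0 = g z0" and z: "z \<in> topspace Z"
  shows "f z = g z"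
proof -
  obtain \<gamma> where \<gamma>: "pathin Z \<gamma>" "\<gamma> 0 = z0" "\<gamma> 1 = z"
    using Z z0 z unfolding path_connected_space_def by blast
  have "f (\<gamma> 1) = g (\<gamma> 1)"
  proof (rule unique_lift_of_path[OF \<open>UPL\<close>])
    show "pathin XH (\<lambda>t. f (\<gamma> t))" "pathin XH (\<lambda>t. g (\<gamma> t))"
      using continuous_map_compose_fun[OF \<gamma>(1)[unfolded pathin_def]] f g by (simp_all add: pathin_def)
    show "hat_proj (f (\<gamma> t)) = hat_proj (g (\<gamma> t))" if "t \<in> {0..1}" for t
      using proj pathin_in_topspace[OF \<gamma>(1)] that by simp
  qed (use z0 \<gamma> in simp_all)
  then show ?thesis
    using \<gamma>(3) by simp
qed

text \<open>
  If the connecting paths exist in \<open>Z\<close>, they exist in \<open>Z \<times> I\<close>, so the homotopy has a lift with the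
  prescribed value at one point \<open>(z0, 0)\<close>. Its restriction to time 0 and the prescribed map \<open>g\<close>
  lift the same map and agree at \<open>z0\<close>.
\<close>

lemma homotopy_lifting_equiconnected:
  assumes UPL and L: "equiconnecting Z L" and Z: "topspace Z \<noteq> {}"
  shows "homotopy_lifting_property Z XH X hat_proj"
  unfolding homotopy_lifting_property_def
proof (intro allI impI, elim conjE)
  let ?T = "prod_topology Z unit_interval"
  fix g h
  assume g: "continuous_map Z XH g" and h: "continuous_map ?T X h"
    and gh: "\<forall>z\<in>topspace Z. h (z, 0) = hat_proj (g z)"
  obtain z0 where z0: "z0 \<in> topspace Z"
    using Z by blast
  then have "g z0 \<in> topspace XH"
    using g by (auto simp: continuous_map_def)
  then obtain \<alpha> where \<alpha>: "g z0 = cls \<alpha>" "\<alpha> \<in> P"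
    by (auto simp: topspace_XH)
  have z0': "(z0, 0) \<in> topspace ?T"
    using z0 by simp
  have "h (z0, 0) = \<alpha> 1"
    using gh z0 \<alpha> by (simp add: hat_proj_cls)
  note lift = equiconnected_lift[OF equiconnecting_prod[OF L equiconnecting_convex[of "{0..1::real}"]]
      h z0' \<alpha>(2) this, simplified convex_real_interval]
  then obtain k where k: "continuous_map ?T XH k" "k (z0, 0) = g z0"
    "\<And>z. z \<in> topspace ?T \<Longrightarrow> hat_proj (k z) = h z"
    using \<alpha>(1) by force
  have k0: "continuous_map Z XH (\<lambda>z. k (z, 0))"
    by (rule continuous_map_compose_fun[OF continuous_map_pairedI k(1)]) simp_all
  have "k (z, 0) = g z" if "z \<in> topspace Z" for z
    by (rule unique_lift_of_map[OF \<open>UPL\<close> equiconnecting_imp_path_connected_space[OF L] k0 g _ z0])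
      (use k gh that in simp_all)
  then show "\<exists>k. continuous_map ?T XH k \<and> (\<forall>z\<in>topspace Z. k (z, 0) = g z) \<and>
      (\<forall>z\<in>topspace Z. \<forall>t\<in>{0..1}. hat_proj (k (z, t)) = h (z, t))"
    using k by (intro exI[of _ k]) simp
qed

lemma UPL_imp_Peano_covering_map:
  assumes UPL
  shows "Peano_covering_map XH X hat_proj"
  unfolding Peano_covering_map_def Serre_fibration_def
proof (intro conjI allI ballI Peano_map_hat_proj continuous_map_hat_proj)
  fix n
  have "equiconnecting (cube n) (\<lambda>x y t. \<lambda>i\<in>{..<n}. (1 - t) *\<^sub>R x i + t *\<^sub>R y i)"
    unfolding cube_def
    by (rule equiconnecting_product[where L = "\<lambda>_ x y t. (1 - t) *\<^sub>R x + t *\<^sub>R y"], rule equiconnecting_convex) simp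
  moreover have "topspace (cube n) \<noteq> {}"
    by (simp add: cube_def PiE_eq_empty_iff)
  ultimately show "homotopy_lifting_property (cube n) XH X hat_proj"
    by (rule homotopy_lifting_equiconnected[OF assms])
next
  fix b C
  let ?F = "subtopology XH {c \<in> topspace XH. hat_proj c = b}"
  assume "C \<in> path_components_of ?F"
  then obtain c where c: "C = path_component_of_set ?F c" "c \<in> topspace ?F"
    unfolding path_components_of_def by (rule imageE)
  have "d = c" if "path_component_of ?F c d" for d
  proof -
    from that obtain g where g: "pathin ?F g" "g 0 = c" "g 1 = d"
      unfolding path_component_of_def by (elim exE conjE)
    have "g 1 = c"
    proof (rule unique_lift_of_path[OF assms, of g "\<lambda>_. c" 1])
      show "pathin XH g" "pathin XH (\<lambda>_. c)"
        using g(1) c(2) by (simp_all add: pathin_subtopology)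
      show "hat_proj (g s) = hat_proj c" if "s \<in> {0..1}" for s
        using g(1) c(2) that by (simp add: pathin_subtopology)
    qed (use g(2) in simp_all)
    with g(3) show ?thesis by simp
  qed
  moreover have "path_component_of ?F c c"
    using c(2) by (simp only: path_component_of_refl)
  ultimately show "\<exists>a. C = {a}"
    unfolding c(1) by (intro exI[of _ c] equalityI subsetI) simp_all
qed

end


section \<open>Serre fibrations with path-totally-disconnected fibres\<close>

text \<open>
  The path \<open>\<omega>\<close> runs back along \<open>\<alpha>\<close> and out along \<open>\<beta>\<close>; at time \<open>s\<close> it lies over the point with
  parameter \<open>t * \<bar>1 - 2 * s\<bar>\<close> of the common projection. Replacing \<open>\<bar>1 - 2 * s\<bar>\<close> by its maximum
  with \<open>u\<close> contracts the projected loop and is constant where \<open>s\<close> is 0 or 1 or where \<open>u\<close> is 1.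
\<close>

lemma Serre_fibration_unique_lift:
  assumes fib: "Serre_fibration A B f"
    and fibres: "\<And>b C. b \<in> topspace B \<Longrightarrow>
      C \<in> path_components_of (subtopology A {a \<in> topspace A. f a = b}) \<Longrightarrow> \<exists>a. C = {a}"
    and \<alpha>: "pathin A \<alpha>" and \<beta>: "pathin A \<beta>" and start: "\<alpha> 0 = \<beta> 0"
    and proj: "\<And>t. t \<in> {0..1} \<Longrightarrow> f (\<alpha> t) = f (\<beta> t)"
    and t: "t \<in> {0..1}"
  shows "\<alpha> t = \<beta> t"
proof -
  have f: "continuous_map A B f" and lifting: "homotopy_lifting_property (cube 1) A B f"
    using fib by (auto simp: Serre_fibration_def)
  let ?T = "prod_topology (cube 1) unit_interval"
  define \<omega> where "\<omega> = path_reverse (\<lambda>s. \<alpha> (t * s)) \<star> (\<lambda>s. \<beta> (t * s))"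
  define g where "g = (\<lambda>z::nat \<Rightarrow> real. \<omega> (z 0))"
  define h where "h = (\<lambda>(z::nat \<Rightarrow> real, u). f (\<alpha> (t * max \<bar>1 - 2 * z 0\<bar> u)))"
  define e where "e = (\<lambda>s::real. \<lambda>i\<in>{..<1::nat}. s)"
  have eval: "continuous_map (cube 1) unit_interval (\<lambda>z. z 0)"
    unfolding cube_def by (rule continuous_map_product_projection) simp
  have e: "continuous_map unit_interval (cube 1) e"
    unfolding cube_def e_def by (auto simp: continuous_map_componentwise)
  have e_in: "e s \<in> topspace (cube 1)" if "s \<in> {0..1}" for s
    using e that by (auto simp: continuous_map_def)
  have e0: "e s 0 = s" for s
    by (simp add: e_def)
  have scale: "pathin unit_interval (\<lambda>s. t * s)"
    using t by (intro pathin_unit_intervalI continuous_intros) (simp_all add: mult_le_one)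
  have \<omega>: "pathin A \<omega>"
    unfolding \<omega>_def using start
    by (intro pathin_join pathin_reverse pathin_reparametrize[OF _ scale] \<alpha> \<beta>) simp
  have \<omega>_proj: "f (\<omega> s) = f (\<alpha> (t * \<bar>1 - 2 * s\<bar>))" if "s \<in> {0..1}" for s
  proof (cases "s \<le> 1/2")
    case True
    then show ?thesis by (simp add: \<omega>_def path_join_def path_reverse_def)
  next
    case False
    then have "t * (2 * s - 1) \<in> {0..1}"
      using t that by (simp add: mult_le_one)
    with False show ?thesis
      using proj[of "t * (2 * s - 1)"] by (simp add: \<omega>_def path_join_def)
  qed
  have g: "continuous_map (cube 1) A g"
    unfolding g_def using eval \<omega>[unfolded pathin_def] by (rule continuous_map_compose_fun)
  have r: "continuous_map ?T unit_interval (\<lambda>w. t * max \<bar>1 - 2 * fst w 0\<bar> (snd w))"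
  proof (rule continuous_map_into_subtopology)
    have "continuous_map ?T euclideanreal (\<lambda>w. fst w 0)"
      using continuous_map_into_fulltopology[OF continuous_map_compose_fun[OF continuous_map_fst eval]] .
    moreover have "continuous_map ?T euclideanreal snd"
      using continuous_map_into_fulltopology[OF continuous_map_snd] .
    ultimately show "continuous_map ?T euclideanreal (\<lambda>w. t * max \<bar>1 - 2 * fst w 0\<bar> (snd w))"
      by (intro continuous_intros) simp_all
    show "(\<lambda>w. t * max \<bar>1 - 2 * fst w 0\<bar> (snd w)) \<in> topspace ?T \<rightarrow> {0..1}"
    proof
      fix w assume "w \<in> topspace ?T"
      then have "fst w 0 \<in> {0..1}" "snd w \<in> {0..1}"
        using eval by (auto simp: continuous_map_def)
      then have "0 \<le> max \<bar>1 - 2 * fst w 0\<bar> (snd w)" "max \<bar>1 - 2 * fst w 0\<bar> (snd w) \<le> 1"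
        by auto
      then show "t * max \<bar>1 - 2 * fst w 0\<bar> (snd w) \<in> {0..1}"
        using t by (simp add: mult_le_one)
    qed
  qed
  have h: "continuous_map ?T B h"
    unfolding h_def case_prod_unfold
    by (rule continuous_map_compose_fun[OF continuous_map_compose_fun[OF r \<alpha>[unfolded pathin_def]] f])
  have "h (z, 0) = f (g z)" if "z \<in> topspace (cube 1)" for z
  proof -
    have "z 0 \<in> {0..1}"
      using eval that by (auto simp: continuous_map_def)
    then show ?thesis
      by (simp add: h_def g_def \<omega>_proj)
  qed
  then obtain k where k: "continuous_map ?T A k" "\<And>z. z \<in> topspace (cube 1) \<Longrightarrow> k (z, 0) = g z"
    "\<And>z u. z \<in> topspace (cube 1) \<Longrightarrow> u \<in> {0..1} \<Longrightarrow> f (k (z, u)) = h (z, u)"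
    using lifting g h unfolding homotopy_lifting_property_def by metis
  have b_in: "f (\<alpha> t) \<in> topspace B"
    using f pathin_in_topspace[OF \<alpha>] t by (auto simp: continuous_map_def)
  let ?F = "subtopology A {a \<in> topspace A. f a = f (\<alpha> t)}"
  \<comment> \<open>on the three sides of the square other than the bottom the maximum is 1, so the lift stays in the fibre\<close>
  have side: "pathin ?F (\<lambda>s. k (e (p s), q s))"
    if p: "pathin unit_interval p" and q: "pathin unit_interval q"
      and pq: "\<And>s. s \<in> {0..1} \<Longrightarrow> max \<bar>1 - 2 * p s\<bar> (q s) = 1" for p q
  proof -
    have "pathin A (\<lambda>s. k (e (p s), q s))"
      unfolding pathin_def
      by (rule continuous_map_compose_fun[OF continuous_map_pairedI k(1)])
        (use continuous_map_compose_fun[OF p[unfolded pathin_def] e] q in \<open>simp_all add: pathin_def\<close>)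
    moreover have "f (k (e (p s), q s)) = f (\<alpha> t)" if "s \<in> {0..1}" for s
    proof -
      have "p s \<in> {0..1}" "q s \<in> {0..1}"
        using pathin_in_topspace[OF p] pathin_in_topspace[OF q] that by auto
      then show ?thesis
        using k(3)[OF e_in] pq[OF that] by (simp add: h_def e0)
    qed
    ultimately show ?thesis
      using pathin_in_topspace[of A "\<lambda>s. k (e (p s), q s)"] by (simp add: pathin_subtopology)
  qed
  have left: "pathin ?F (\<lambda>s. k (e 0, s))"
    by (rule side[of "\<lambda>_. 0" "\<lambda>s. s"]) (auto intro!: pathin_unit_intervalI continuous_intros)
  have top: "pathin ?F (\<lambda>s. k (e s, 1))"
    by (rule side[of "\<lambda>s. s" "\<lambda>_. 1"]) (auto intro!: pathin_unit_intervalI continuous_intros)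
  have right: "pathin ?F (\<lambda>s. k (e 1, 1 - s))"
    by (rule side[of "\<lambda>_. 1" "\<lambda>s. 1 - s"]) (auto intro!: pathin_unit_intervalI continuous_intros)
  have "pathin ?F ((\<lambda>s. k (e 0, s)) \<star> ((\<lambda>s. k (e s, 1)) \<star> (\<lambda>s. k (e 1, 1 - s))))" (is "pathin _ ?\<sigma>")
    by (intro pathin_join left top right) simp_all
  moreover have "?\<sigma> 0 = \<alpha> t" "?\<sigma> 1 = \<beta> t"
    using k(2)[OF e_in] by (simp_all add: g_def e0 \<omega>_def)
  ultimately have comp: "path_component_of ?F (\<alpha> t) (\<beta> t)"
    unfolding path_component_of_def by blast
  then have "\<alpha> t \<in> topspace ?F"
    by (auto dest: path_component_in_topspace)
  then have "path_component_of_set ?F (\<alpha> t) \<in> path_components_of ?F" "path_component_of ?F (\<alpha> t) (\<alpha> t)"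
    by (auto simp: path_components_of_def path_component_of_refl)
  then obtain a where "path_component_of_set ?F (\<alpha> t) = {a}"
    using fibres[OF b_in] by blast
  then have "\<alpha> t = a" "\<beta> t = a"
    using comp \<open>path_component_of ?F (\<alpha> t) (\<alpha> t)\<close> by blast+
  then show ?thesis by simp
qed

lemma (in path_subgroup) Peano_covering_map_imp_UPL:
  assumes "Peano_covering_map XH X hat_proj"
  shows UPL
  unfolding unique_path_lifting_def
proof (intro conjI allI impI; (elim conjE)?)
  show "continuous_map XH X hat_proj" by (rule continuous_map_hat_proj)
  show "base \<in> topspace XH" "hat_proj base = x\<^sub>0"
    using const_in_P by (simp_all add: base_eq topspace_XH hat_proj_cls)
next
  fix \<alpha> assume "pathin X \<alpha>" "\<alpha> 0 = x\<^sub>0"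
  then have "\<alpha> \<in> P"
    by (simp add: P_iff)
  then show "\<exists>\<beta>. pathin XH \<beta> \<and> \<beta> 0 = base \<and> (\<forall>t\<in>{0..1}. hat_proj (\<beta> t) = \<alpha> t)"
    using path_lift_base by metis
next
  fix \<alpha> \<beta>
  assume paths: "pathin XH \<alpha>" "pathin XH \<beta>" and ends: "\<alpha> 0 = base" "\<beta> 0 = base"
    and proj: "\<forall>t\<in>{0..1}. hat_proj (\<alpha> t) = hat_proj (\<beta> t)"
  have fib: "Serre_fibration XH X hat_proj"
    using assms by (simp add: Peano_covering_map_def)
  have fibres: "\<exists>a. C = {a}" if "b \<in> topspace X"
    "C \<in> path_components_of (subtopology XH {c \<in> topspace XH. hat_proj c = b})" for b C
    using assms that unfolding Peano_covering_map_def by blast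
  show "\<forall>t\<in>{0..1}. \<alpha> t = \<beta> t"
  proof
    fix t :: real assume t: "t \<in> {0..1}"
    have start: "\<alpha> 0 = \<beta> 0"
      using ends by simp
    show "\<alpha> t = \<beta> t"
      by (rule Serre_fibration_unique_lift[OF fib _ paths start _ t]; (rule fibres bspec[OF proj])) assumption+
  qed
qed

theorem theorem6p4:
  fixes X :: "'a topology" and x\<^sub>0 :: 'a and H :: "(real \<Rightarrow> 'a) set set"
  assumes "path_connected_space X"
    and "x\<^sub>0 \<in> topspace X"
    and "subgroup H (fundamental_group X x\<^sub>0)"
  shows "unique_path_lifting (hat_space X x\<^sub>0 H) (hat_base X x\<^sub>0 H) X x\<^sub>0 hat_proj \<longleftrightarrow>
         Peano_covering_map (hat_space X x\<^sub>0 H) X hat_proj"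
proof -
  interpret path_subgroup X x\<^sub>0 H
    by (intro path_subgroup.intro assms)
  show ?thesis
    using UPL_imp_Peano_covering_map Peano_covering_map_imp_UPL by blast
qed

end
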